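(* Let $K\ge1$ be fixed, $\boldsymbol{\beta}_0\in\mathbb{R}^K$, and for each $n>K$ let the $n\times K$ design matrix $\mathbf{X}$ with rows $\mathbf{x}_i$ satisfy $\mathbf{X}^t\mathbf{X}=n\mathbf{I}$, $\sum_{i=1}^n x_{i,k}=0$ for each $k$, and $\max_{1\le i\le n}\|\mathbf{x}_i\|/\sqrt n\to0$. Suppose $Y_i=\mathbf{x}_i^t\boldsymbol{\beta}_0+\varepsilon_i$ with $\varepsilon_i$ independent, $\mathbb{E}(\varepsilon_i)=0$, $\mathbb{E}(\varepsilon_i^2)=\sigma_0^2>0$, $\mathbb{E}(\varepsilon_i^4)\le M<\infty$. Consider the rescaled spike and slab model with $\lambda_n=n$ and $\sigma^2\equiv1$. (a) If the support of $\pi$ contains a set $[\eta_0,\infty)^K$ for some finite $\eta_0\ge0$, then for each $\delta\in(0,1)$ and each $k$ with $\beta_{k,0}\ne0$, $\pi_n(\{\boldsymbol{\gamma}:\gamma_k/(1+\gamma_k)>1-\delta\}\mid\mathbf{Y}^* )\to1$ in probability as $n\to\infty$, where $\pi_n(\cdot\mid\mathbf{Y}^* )$ is the posterior of $\boldsymbol{\gamma}$. (b) If $\pi$ is the continuous bimodal prior, then the posterior density $f_k^*(\cdot\mid w)$ of $\gamma_k$ given $w$ satisfies $$f_k^*(u\mid w)\propto\exp\Big(\frac{u}{2(1+u)}\xi_{k,n}^2\Big)(1+u)^{-1/2}\big((1-w)g_0(u)+wg_1(u)\big),\quad u>0,$$ where $g_0(u)=v_0u^{-2}g(v_0u^{-1})$,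 $g_1(u)=u^{-2}g(u^{-1})$, $g(u)=\frac{a_2^{a_1}}{(a_1-1)!}u^{a_1-1}\exp(-a_2u)$ and $\xi_{k,n}=\widehat\sigma_n^{-1}n^{-1/2}\sum_{i=1}^n x_{i,k}Y_i$. Moreover, if $\beta_{k,0}=0$ then $\xi_{k,n}$ converges in distribution to $N(0,1)$.
   Context: $\mathbf{Y}=(Y_1,\dots,Y_n)^t$, OLS $\widehat{\boldsymbol{\beta}}_n^\circ=(\mathbf{X}^t\mathbf{X})^{-1}\mathbf{X}^t\mathbf{Y}$, $\widehat\sigma_n^2=\|\mathbf{Y}-\mathbf{X}\widehat{\boldsymbol{\beta}}_n^\circ\|^2/(n-K)$. Rescaled spike and slab model: $Y_i^*=\widehat\sigma_n^{-1}n^{1/2}Y_i$, and as data $\mathbf{Y}^*=(Y_1^*,\dots,Y_n^* )^t$ is modeled by $(Y_i^*\mid\boldsymbol{\beta},\sigma^2)$ independent $N(\mathbf{x}_i^t\boldsymbol{\beta},\sigma^2\lambda_n)$, $(\boldsymbol{\beta}\mid\boldsymbol{\gamma})\sim N(\mathbf{0},\mathrm{diag}(\gamma_1,\dots,\gamma_K))$, $\boldsymbol{\gamma}\sim\pi$ with $\pi\{\gamma_k>0\}=1$. Continuous bimodal prior: $\gamma_k=\mathcal{I}_k\tau_k^2$, where given $w$ the $\mathcal{I}_k$ are i.i.d. with $\mathbb{P}(\mathcal{I}_k=v_0)=1-w$, $\mathbb{P}(\mathcal{I}_k=1)=w$ ($v_0>0$ a fixed small constant), $\tau_k^{-2}$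 are i.i.d. Gamma with shape $a_1$ and rate $a_2$ (density $g$), independent of the $\mathcal{I}_k$, and $w\sim\mathrm{Uniform}[0,1]$; $a_1$ is a positive integer, $a_2>0$. *)

theory Defs
  imports "HOL-Probability.Probability"
begin

text \<open>Vectors in R^K are functions nat => real, only coordinates k < K matter.
  A design matrix for sample size n is Xn :: nat => nat => real, Xn i k for i < n, k < K.\<close>

text \<open>OLS estimator: the (unique, when X^t X is invertible) solution of the normal equations
  X^t X b = X^t y, i.e. (X^t X)^{-1} X^t y.\<close>
definition ols :: "nat \<Rightarrow> nat \<Rightarrow> (nat \<Rightarrow> nat \<Rightarrow> real) \<Rightarrow> (nat \<Rightarrow> real) \<Rightarrow> (nat \<Rightarrow> real)" where
  "ols K n Xn y = (THE b. b \<in> extensional {..<K} \<and>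
      (\<forall>k<K. (\<Sum>i<n. Xn i k * (\<Sum>l<K. Xn i l * b l)) = (\<Sum>i<n. Xn i k * y i)))"

definition sigma_hat2 :: "nat \<Rightarrow> nat \<Rightarrow> (nat \<Rightarrow> nat \<Rightarrow> real) \<Rightarrow> (nat \<Rightarrow> real) \<Rightarrow> real" where
  "sigma_hat2 K n Xn y =
     (\<Sum>i<n. (y i - (\<Sum>k<K. Xn i k * ols K n Xn y k))\<^sup>2) / (real n - real K)"

definition ystar :: "nat \<Rightarrow> nat \<Rightarrow> (nat \<Rightarrow> nat \<Rightarrow> real) \<Rightarrow> (nat \<Rightarrow> real) \<Rightarrow> (nat \<Rightarrow> real)" where
  "ystar K n Xn y = (\<lambda>i. sqrt (real n) / sqrt (sigma_hat2 K n Xn y) * y i)"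

text \<open>Marginal likelihood of gamma in the spike and slab model:
  Y*_i | beta ~ N(x_i^t beta, sigma^2 lambda) independent, beta | gamma ~ N(0, diag gamma);
  the parameter sig2lam is sigma^2 * lambda_n (a variance).\<close>
definition ss_lik :: "nat \<Rightarrow> nat \<Rightarrow> (nat \<Rightarrow> nat \<Rightarrow> real) \<Rightarrow> real \<Rightarrow> (nat \<Rightarrow> real) \<Rightarrow> (nat \<Rightarrow> real) \<Rightarrow> real" where
  "ss_lik K n Xn sig2lam ys \<gamma> =
     (\<integral>b. (\<Prod>i<n. normal_density (\<Sum>k<K. Xn i k * b k) (sqrt sig2lam) (ys i)) *
          (\<Prod>k<K. normal_density 0 (sqrt (\<gamma> k)) (b k))
       \<partial>(\<Pi>\<^sub>M k\<in>{..<K}. lborel))"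

definition posterior :: "(nat \<Rightarrow> real) measure \<Rightarrow> ((nat \<Rightarrow> real) \<Rightarrow> real) \<Rightarrow> (nat \<Rightarrow> real) set \<Rightarrow> real" where
  "posterior pri L A = (\<integral>\<gamma>. indicator A \<gamma> * L \<gamma> \<partial>pri) / (\<integral>\<gamma>. L \<gamma> \<partial>pri)"

definition in_support :: "nat \<Rightarrow> (nat \<Rightarrow> real) measure \<Rightarrow> (nat \<Rightarrow> real) \<Rightarrow> bool" where
  "in_support K pri x \<longleftrightarrow>
     (\<forall>e>0. emeasure pri {g \<in> space pri. \<forall>k<K. \<bar>g k - x k\<bar> < e} > 0)"

text \<open>Convergence in probability of Z n to the constant c (stated with outer
  probability, so it does not depend on measurability of the events).\<close>
definition conv_in_prob :: "'a measure \<Rightarrow> (nat \<Rightarrow> 'a \<Rightarrow> real) \<Rightarrow> real \<Rightarrow> bool" where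
  "conv_in_prob M Z c \<longleftrightarrow>
     (\<forall>e>0. \<forall>d>0. eventually (\<lambda>n. \<exists>A\<in>sets M. measure M A < d \<and>
                        {\<omega> \<in> space M. \<bar>Z n \<omega> - c\<bar> > e} \<subseteq> A) sequentially)"

definition gdens :: "nat \<Rightarrow> real \<Rightarrow> real \<Rightarrow> real" where
  "gdens a1 a2 u = a2 ^ a1 / fact (a1 - 1) * u ^ (a1 - 1) * exp (- a2 * u)"

text \<open>Law of gamma_k = I_k tau_k^2 given w: I_k = v0 w.p. 1-w, = 1 w.p. w,
  tau_k^{-2} ~ Gamma(a1,a2) independent of I_k.\<close>
definition bimodal_comp :: "real \<Rightarrow> nat \<Rightarrow> real \<Rightarrow> real \<Rightarrow> real measure" where
  "bimodal_comp v0 a1 a2 w =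
     distr (measure_pmf (map_pmf (\<lambda>b. if b then 1 else v0) (bernoulli_pmf w)) \<Otimes>\<^sub>M
            density lborel (\<lambda>t. indicator {0<..} t * gdens a1 a2 t))
           borel (\<lambda>(i, t). i * (1 / t))"

definition bimodal_prior_given_w :: "nat \<Rightarrow> real \<Rightarrow> nat \<Rightarrow> real \<Rightarrow> real \<Rightarrow> (nat \<Rightarrow> real) measure" where
  "bimodal_prior_given_w K v0 a1 a2 w = (\<Pi>\<^sub>M k\<in>{..<K}. bimodal_comp v0 a1 a2 w)"

end

theory Submission
  imports Defs
begin

text \<open>
  For an orthogonal design with \<open>\<lambda>\<^sub>n = n\<close> the Gaussian likelihood factorises over the coordinates,
  and integrating out \<open>\<beta>\<close> leaves, up to a constant, the product over \<open>k\<close> of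
  \<open>exp (\<gamma>\<^sub>k / (2 (1 + \<gamma>\<^sub>k)) \<xi>\<^sub>k\<^sup>2) (1 + \<gamma>\<^sub>k) powr (-1/2)\<close>.

  Part (b) follows because the bimodal prior given \<open>w\<close> is a product measure, so all coordinates but
  the \<open>k\<close>-th cancel. For part (a), bound the likelihood from above on
  \<open>{\<gamma>\<^sub>k / (1 + \<gamma>\<^sub>k) \<le> 1 - \<delta>}\<close> and bound the normalising constant from below by the mass of a box
  \<open>[T, T + 2]\<^sup>K\<close>: the posterior of the former set is at most a constant times
  \<open>exp ((\<Sum>\<^sub>l \<xi>\<^sub>l\<^sup>2 / (1 + T) - \<delta> \<xi>\<^sub>k\<^sup>2) / 2)\<close>. Since \<open>\<xi>\<^sub>l\<^sup>2 / n\<close> converges in probability to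
  \<open>\<beta>\<^sub>l\<^sup>2 / \<sigma>\<^sub>0\<^sup>2\<close>, this decays exponentially in \<open>n\<close> once \<open>T\<close> is large. The limit law of \<open>\<xi>\<^sub>k\<close> is Lyapunov's
  central limit theorem for a triangular array of weights, combined with Slutsky's lemma; both are
  carried out on characteristic functions.
\<close>

section \<open>Orthogonal designs and the marginal likelihood\<close>

definition orthogonal_design :: "nat \<Rightarrow> nat \<Rightarrow> (nat \<Rightarrow> nat \<Rightarrow> real) \<Rightarrow> bool" where
  "orthogonal_design K n x \<longleftrightarrow> K < n \<and>
     (\<forall>k<K. \<forall>l<K. (\<Sum>i<n. x i k * x i l) = (if k = l then real n else 0))"

text \<open>This is coordinate \<open>k\<close> of \<open>X^t X b = n b\<close>. Every quadratic or
  cross term in the design is reduced to a coordinatewise sum through it.\<close>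

lemma orthogonal_design_normal_equations:
  assumes "orthogonal_design K n x" "k < K"
  shows "(\<Sum>i<n. x i k * (\<Sum>l<K. x i l * b l)) = real n * b k"
proof -
  have "(\<Sum>i<n. x i k * (\<Sum>l<K. x i l * b l)) = (\<Sum>l<K. \<Sum>i<n. x i k * x i l * b l)"
    by (subst sum.swap) (simp add: sum_distrib_left mult.assoc)
  also have "\<dots> = (\<Sum>l<K. (if k = l then real n else 0) * b l)"
    using assms by (simp add: orthogonal_design_def flip: sum_distrib_right)
  also have "\<dots> = (\<Sum>l<K. if l = k then real n * b l else 0)"
    by (intro sum.cong) auto
  finally show ?thesis
    using assms(2) by simp
qed

text \<open>The normal equations decouple into \<open>n * b k = (\<Sum>i<n. x i k * y i)\<close>,
  one for each \<open>k < K\<close>. This gives both existence and uniqueness for the definite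
  description; outside \<open>{..<K}\<close> the candidates agree by extensionality.\<close>

lemma ols_orthogonal_design:
  assumes "orthogonal_design K n x" "k < K"
  shows "ols K n x y k = (\<Sum>i<n. x i k * y i) / n"
proof -
  have n: "n > 0" using assms by (auto simp: orthogonal_design_def)
  define b0 where "b0 k = (\<Sum>i<n. x i k * y i) / n" for k
  have "ols K n x y = restrict b0 {..<K}"
    unfolding ols_def
  proof (rule the_equality, goal_cases)
    case 1
    then show ?case
      using n by (simp add: orthogonal_design_normal_equations[OF assms(1)]) (simp add: b0_def)
  next
    case (2 b)
    then have "\<forall>k<K. real n * b k = (\<Sum>i<n. x i k * y i)"
      by (simp add: orthogonal_design_normal_equations[OF assms(1)])
    with 2 n show ?case
      by (intro extensionalityI[where A="{..<K}"]) (auto simp: field_simps b0_def)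
  qed
  then show ?thesis using assms(2) by (simp add: b0_def)
qed

text \<open>Pythagoras: the estimation error of OLS is \<open>s = X^t e / n\<close>, so the residual
  is \<open>e - X s\<close> and \<open>\<beta>\<close> drops out. Both the inner product of
  \<open>e\<close> with \<open>X s\<close> and the squared norm of \<open>X s\<close> equal
  \<open>n\<close> times the squared norm of \<open>s\<close>.\<close>

lemma sigma_hat2_regression:
  assumes "orthogonal_design K n x"
  shows "sigma_hat2 K n x (\<lambda>i. (\<Sum>l<K. x i l * \<beta> l) + e i) =
    ((\<Sum>i<n. (e i)\<^sup>2) - real n * (\<Sum>k<K. ((\<Sum>i<n. x i k * e i) / n)\<^sup>2)) / (real n - real K)"
proof -
  let ?y = "\<lambda>i. (\<Sum>l<K. x i l * \<beta> l) + e i"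
  define s where "s k = (\<Sum>i<n. x i k * e i) / n" for k
  have n: "n > 0" using assms by (auto simp: orthogonal_design_def)
  have b: "ols K n x ?y k = \<beta> k + s k" if "k < K" for k
    using n that by (simp add: ols_orthogonal_design[OF assms] distrib_left sum.distrib
        orthogonal_design_normal_equations[OF assms] add_divide_distrib s_def)
  have res: "?y i - (\<Sum>k<K. x i k * ols K n x ?y k) = e i - (\<Sum>k<K. x i k * s k)" for i
    by (simp add: b distrib_left sum.distrib)
  have xe: "(\<Sum>i<n. x i k * e i) = n * s k" for k
    using n by (simp add: s_def)
  have cross: "(\<Sum>i<n. e i * (\<Sum>k<K. x i k * s k)) = n * (\<Sum>k<K. (s k)\<^sup>2)"
  proof -
    have "(\<Sum>i<n. e i * (\<Sum>k<K. x i k * s k)) = (\<Sum>k<K. (\<Sum>i<n. x i k * e i) * s k)"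
      by (simp add: sum_distrib_left sum_distrib_right mult_ac) (rule sum.swap)
    then show ?thesis unfolding xe by (simp add: power2_eq_square sum_distrib_left mult_ac)
  qed
  have sq: "(\<Sum>i<n. (\<Sum>k<K. x i k * s k)\<^sup>2) = n * (\<Sum>k<K. (s k)\<^sup>2)"
  proof -
    have "(\<Sum>i<n. (\<Sum>k<K. x i k * s k)\<^sup>2) = (\<Sum>k<K. (\<Sum>i<n. x i k * (\<Sum>l<K. x i l * s l)) * s k)"
      by (simp add: power2_eq_square sum_distrib_left sum_distrib_right mult_ac) (rule sum.swap)
    then show ?thesis
      by (simp add: orthogonal_design_normal_equations[OF assms]) (simp add: power2_eq_square sum_distrib_left mult_ac)
  qed
  have "(\<Sum>i<n. (e i - (\<Sum>k<K. x i k * s k))\<^sup>2) = (\<Sum>i<n. (e i)\<^sup>2) - n * (\<Sum>k<K. (s k)\<^sup>2)"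
    by (simp add: power2_diff sum.distrib sum_subtractf sq cross mult.assoc flip: sum_distrib_left)
  then show ?thesis
    unfolding sigma_hat2_def res by (simp add: s_def)
qed

section \<open>The marginal likelihood ratio of one coordinate\<close>

text \<open>The density ratio of \<open>N(0, 1 + u)\<close> to \<open>N(0, 1)\<close> at
  \<open>z\<close>: the Bayes factor for \<open>z\<close> drawn from \<open>N(b, 1)\<close> with
  \<open>b\<close> from \<open>N(0, u)\<close>, against \<open>b = 0\<close>.\<close>

definition shrinkage_factor :: "real \<Rightarrow> real \<Rightarrow> real" where
  "shrinkage_factor z u = exp (u / (2 * (1 + u)) * z\<^sup>2) * (1 + u) powr (-1/2)"

lemma shrinkage_factor_measurable [measurable]: "shrinkage_factor z \<in> borel_measurable borel"
  by (simp add: shrinkage_factor_def[abs_def])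

lemma shrinkage_factor_pos: "u > -1 \<Longrightarrow> 0 < shrinkage_factor z u"
  by (simp add: shrinkage_factor_def)

text \<open>The polynomial factor is at most 1. Two values of \<open>c\<close> matter:
  \<open>1\<close> holds for every variance, and \<open>1 - \<delta>\<close> holds where the
  shrinkage weight of a coordinate fails to exceed \<open>1 - \<delta>\<close>.\<close>

lemma shrinkage_factor_le:
  assumes "u \<ge> 0" "u / (1 + u) \<le> c"
  shows "shrinkage_factor z u \<le> exp (c * z\<^sup>2 / 2)"
proof -
  have "u / (2 * (1 + u)) * z\<^sup>2 \<le> c * z\<^sup>2 / 2"
    using mult_right_mono[OF assms(2), of "z\<^sup>2 / 2"] by (simp add: field_simps)
  moreover have "(1 + u) powr (-1/2) \<le> 1"
    using assms powr_mono[of "-1/2" 0 "1+u"] by simp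
  ultimately show ?thesis
    unfolding shrinkage_factor_def by (intro mult_left_le[THEN order_trans]) auto
qed

lemma shrinkage_factor_le_exp: "u \<ge> 0 \<Longrightarrow> shrinkage_factor z u \<le> exp (z\<^sup>2 / 2)"
  using shrinkage_factor_le[of u 1 z] by simp

text \<open>The exponential factor increases in \<open>u\<close> and the power decreases, so the
  first is evaluated at the lower end \<open>T\<close> and the second at the upper end
  \<open>U\<close>.\<close>

lemma shrinkage_factor_ge:
  assumes "0 \<le> T" "T \<le> u" "u \<le> U"
  shows "exp (T / (1 + T) * z\<^sup>2 / 2) * (1 + U) powr (-1/2) \<le> shrinkage_factor z u"
proof -
  have "T / (1 + T) \<le> u / (1 + u)"
    using assms by (simp add: field_simps)
  then have "T / (1 + T) * z\<^sup>2 / 2 \<le> u / (2 * (1 + u)) * z\<^sup>2"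
    using mult_right_mono[of "T / (1 + T)" "u / (1 + u)" "z\<^sup>2 / 2"] by (simp add: field_simps)
  moreover have "(1 + U) powr (-1/2) \<le> (1 + u) powr (-1/2)"
    using assms by (intro powr_mono2') auto
  ultimately show ?thesis
    unfolding shrinkage_factor_def by (intro mult_mono) auto
qed

lemma has_bochner_integral_normal_slab:
  assumes "\<gamma> > 0"
  shows "has_bochner_integral lborel
    (\<lambda>b. exp (b * z - b\<^sup>2 / 2) * normal_density 0 (sqrt \<gamma>) b) (shrinkage_factor z \<gamma>)"
proof -
  \<comment> \<open>Completing the square in \<open>b\<close>: the posterior of the coefficient is
    normal with mean \<open>z * \<gamma> / (1 + \<gamma>)\<close> and variance
    \<open>\<gamma> / (1 + \<gamma>)\<close>, and what remains is free of \<open>b\<close>.\<close>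
  have eq: "exp (b * z - b\<^sup>2 / 2) * normal_density 0 (sqrt \<gamma>) b =
      shrinkage_factor z \<gamma> * normal_density (z * \<gamma> / (1 + \<gamma>)) (sqrt (\<gamma> / (1 + \<gamma>))) b" for b
  proof -
    have 1: "exp (b * z - b\<^sup>2 / 2) * exp (- b\<^sup>2 / (2 * \<gamma>)) = exp (\<gamma> / (2 * (1 + \<gamma>)) * z\<^sup>2) *
        exp (- (b - z * \<gamma> / (1 + \<gamma>))\<^sup>2 / (2 * (\<gamma> / (1 + \<gamma>))))"
    proof -
      have "1 + \<gamma> \<noteq> 0" "\<gamma> \<noteq> 0" using assms by auto
      then have "b * z - b\<^sup>2 / 2 + - b\<^sup>2 / (2 * \<gamma>) = \<gamma> / (2 * (1 + \<gamma>)) * z\<^sup>2 +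
        - (b - z * \<gamma> / (1 + \<gamma>))\<^sup>2 / (2 * (\<gamma> / (1 + \<gamma>)))"
        by (simp add: divide_simps power2_eq_square) (simp add: algebra_simps)
      then show ?thesis by (simp only: exp_add[symmetric])
    qed
    have 2: "1 / sqrt (2 * pi * \<gamma>) = (1 + \<gamma>) powr (-1/2) * (1 / sqrt (2 * pi * (\<gamma> / (1 + \<gamma>))))"
      using assms by (simp add: powr_minus powr_half_sqrt real_sqrt_mult real_sqrt_divide field_simps)
    show ?thesis
      unfolding normal_density_def shrinkage_factor_def
      using assms 1 2 by simp
  qed
  have "has_bochner_integral lborel
      (normal_density (z * \<gamma> / (1 + \<gamma>)) (sqrt (\<gamma> / (1 + \<gamma>)))) 1"
    using assms by (simp add: has_bochner_integral_iff)
  from has_bochner_integral_mult_right[OF this, of "shrinkage_factor z \<gamma>"] show ?thesis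
    by (simp add: eq)
qed

text \<open>Expanding the squares, the cross term and the quadratic term in \<open>b\<close> both
  split over the coordinates. The quadratic term carries a factor \<open>n\<close>, which the
  variance \<open>n\<close> cancels, so each coefficient meets a likelihood of unit
  variance.\<close>

lemma normal_likelihood_orthogonal_design:
  assumes "orthogonal_design K n x"
  shows "(\<Prod>i<n. normal_density (\<Sum>k<K. x i k * b k) (sqrt n) (y i)) =
    (\<Prod>i<n. normal_density 0 (sqrt n) (y i)) *
    (\<Prod>k<K. exp (b k * ((\<Sum>i<n. x i k * y i) / n) - (b k)\<^sup>2 / 2))"
proof -
  have n: "n > 0" using assms by (auto simp: orthogonal_design_def)
  define m where "m i = (\<Sum>k<K. x i k * b k)" for i
  have cross: "(\<Sum>i<n. y i * m i) = (\<Sum>k<K. b k * (\<Sum>i<n. x i k * y i))"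
    unfolding m_def by (simp add: sum_distrib_left mult_ac) (rule sum.swap)
  have sq: "(\<Sum>i<n. (m i)\<^sup>2) = (\<Sum>k<K. n * (b k)\<^sup>2)"
  proof -
    have "(\<Sum>i<n. (m i)\<^sup>2) = (\<Sum>k<K. b k * (\<Sum>i<n. x i k * m i))"
      unfolding m_def by (simp add: power2_eq_square sum_distrib_left sum_distrib_right mult_ac) (rule sum.swap)
    then show ?thesis
      by (simp add: m_def orthogonal_design_normal_equations[OF assms]) (simp add: power2_eq_square mult_ac)
  qed
  have nd: "normal_density (m i) (sqrt n) (y i) =
      normal_density 0 (sqrt n) (y i) * exp ((y i * m i) / n - (m i)\<^sup>2 / (2 * n))" for i
  proof -
    have "- (y i - m i)\<^sup>2 / (2 * n) = - (y i)\<^sup>2 / (2 * n) + ((y i * m i) / n - (m i)\<^sup>2 / (2 * n))"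
      using n by (simp add: field_simps power2_eq_square)
    then have "exp (- (y i - m i)\<^sup>2 / (2 * n)) = exp (- (y i)\<^sup>2 / (2 * n)) * exp ((y i * m i) / n - (m i)\<^sup>2 / (2 * n))"
      by (simp only: exp_add[symmetric])
    then show ?thesis by (simp add: normal_density_def)
  qed
  have "(\<Sum>i<n. (y i * m i) / n - (m i)\<^sup>2 / (2 * n)) = (\<Sum>i<n. y i * m i) / n - (\<Sum>i<n. (m i)\<^sup>2) / (2 * n)"
    by (simp add: sum_subtractf sum_divide_distrib)
  also have "\<dots> = (\<Sum>k<K. b k * ((\<Sum>i<n. x i k * y i) / n) - (b k)\<^sup>2 / 2)"
    using n unfolding cross sq by (simp add: sum_subtractf sum_divide_distrib sum_distrib_left)
  finally have "(\<Prod>i<n. exp ((y i * m i) / n - (m i)\<^sup>2 / (2 * n))) =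
      (\<Prod>k<K. exp (b k * ((\<Sum>i<n. x i k * y i) / n) - (b k)\<^sup>2 / 2))"
    by (simp flip: exp_sum)
  then show ?thesis
    unfolding m_def[symmetric] nd prod.distrib by simp
qed

text \<open>After factorisation of the likelihood the integral over \<open>b\<close> is a product of
  one-dimensional ones. The leading constant does not depend on \<open>\<gamma>\<close> and hence
  cancels in every posterior.\<close>

lemma ss_lik_orthogonal_design:
  assumes "orthogonal_design K n x" and "\<And>k. k < K \<Longrightarrow> 0 < \<gamma> k"
  shows "ss_lik K n x n y \<gamma> = (\<Prod>i<n. normal_density 0 (sqrt n) (y i)) *
    (\<Prod>k<K. shrinkage_factor ((\<Sum>i<n. x i k * y i) / n) (\<gamma> k))"
proof -
  interpret product_sigma_finite "\<lambda>_::nat. lborel :: real measure"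
    by (simp add: product_sigma_finite_def lborel.sigma_finite_measure_axioms)
  define z where "z k = (\<Sum>i<n. x i k * y i) / n" for k
  define C where "C = (\<Prod>i<n. normal_density 0 (sqrt n) (y i))"
  have int: "has_bochner_integral lborel
      (\<lambda>b. exp (b * z k - b\<^sup>2 / 2) * normal_density 0 (sqrt (\<gamma> k)) b) (shrinkage_factor (z k) (\<gamma> k))"
    if "k < K" for k using that by (intro has_bochner_integral_normal_slab assms)
  have "ss_lik K n x n y \<gamma> = (\<integral>b. C * (\<Prod>k<K. exp (b k * z k - (b k)\<^sup>2 / 2) * normal_density 0 (sqrt (\<gamma> k)) (b k))
       \<partial>(\<Pi>\<^sub>M k\<in>{..<K}. lborel))"
    unfolding ss_lik_def normal_likelihood_orthogonal_design[OF assms(1)]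
    by (simp add: prod.distrib mult.assoc C_def z_def)
  also have "\<dots> = C * (\<Prod>k<K. \<integral>b. exp (b * z k - b\<^sup>2 / 2) * normal_density 0 (sqrt (\<gamma> k)) b \<partial>lborel)"
    using int by (subst Bochner_Integration.integral_mult_right_zero, subst product_integral_prod)
      (auto simp: has_bochner_integral_iff)
  also have "\<dots> = C * (\<Prod>k<K. shrinkage_factor (z k) (\<gamma> k))"
    using int by (simp add: has_bochner_integral_iff)
  finally show ?thesis by (simp add: C_def z_def)
qed

section \<open>Posterior under the continuous bimodal prior\<close>

lemma ss_lik_measurable [measurable]:
  "ss_lik K n x v y \<in> borel_measurable (\<Pi>\<^sub>M k\<in>{..<K}. (borel :: real measure))"
proof -
  interpret product_sigma_finite "\<lambda>_::nat. lborel :: real measure"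
    by (simp add: product_sigma_finite_def lborel.sigma_finite_measure_axioms)
  interpret finite_product_sigma_finite "\<lambda>_::nat. lborel :: real measure" "{..<K}"
    by standard simp
  show ?thesis
    unfolding ss_lik_def[abs_def] normal_density_def
    by (rule borel_measurable_lebesgue_integral) measurable
qed

text \<open>The map from \<open>u\<close> to \<open>c / u\<close> is an involution of the positive
  half-line with derivative \<open>- (c / u\<^sup>2)\<close>, so this is the change of variables for
  an injective map.\<close>

lemma set_integral_reciprocal_substitution:
  fixes f :: "real \<Rightarrow> real" and c :: real
  assumes c: "c > 0" and int: "set_integrable lborel {0<..} f"
    and [measurable]: "f \<in> borel_measurable borel"
  shows "set_integrable lborel {0<..} (\<lambda>u. c / u\<^sup>2 * f (c / u))"
    and "(LBINT u:{0<..}. c / u\<^sup>2 * f (c / u)) = (LBINT t:{0<..}. f t)"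
proof -
  let ?S = "{0<..} :: real set"
  have im: "(\<lambda>u. c / u) ` ?S = ?S"
  proof (intro equalityI subsetI)
    fix t assume "t \<in> ?S"
    then show "t \<in> (\<lambda>u. c / u) ` ?S" using c by (intro image_eqI[of _ _ "c / t"]) auto
  qed (use c in auto)
  have deriv: "((\<lambda>u. c / u) has_field_derivative - (c / u\<^sup>2)) (at u within ?S)" if "u \<in> ?S" for u
    using that by (auto intro!: derivative_eq_intros simp: power2_eq_square)
  have inj: "inj_on (\<lambda>u. c / u) ?S"
    using c by (auto simp: inj_on_def field_simps)
  \<comment> \<open>The change of variables lives on the completed measure \<open>lebesgue\<close>;
    for Borel functions it transfers back to \<open>lborel\<close>.\<close>
  have lb: "set_integrable lborel ?S g \<longleftrightarrow> g absolutely_integrable_on ?S"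
    "(LBINT u:?S. g u) = (LINT u:?S|lebesgue. g u)"
    if [measurable]: "g \<in> borel_measurable borel" for g :: "real \<Rightarrow> real"
    unfolding set_integrable_def set_lebesgue_integral_def
    by (subst integrable_completion integral_completion; simp)+
  have "(\<lambda>u. \<bar>- (c / u\<^sup>2)\<bar> * f (c / u)) absolutely_integrable_on ?S \<and>
     integral ?S (\<lambda>u. \<bar>- (c / u\<^sup>2)\<bar> * f (c / u)) = integral ?S f"
    using has_absolute_integral_change_of_variables_1'[OF _ deriv inj, of f "integral ?S f"] int
    by (simp add: im lb)
  then have *: "(\<lambda>u. c / u\<^sup>2 * f (c / u)) absolutely_integrable_on ?S"
     "integral ?S (\<lambda>u. c / u\<^sup>2 * f (c / u)) = integral ?S f"
    using c by simp_all
  then show "set_integrable lborel ?S (\<lambda>u. c / u\<^sup>2 * f (c / u))"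
    by (simp add: lb)
  show "(LBINT u:?S. c / u\<^sup>2 * f (c / u)) = (LBINT t:?S. f t)"
    using * int by (simp add: lb set_lebesgue_integral_eq_integral)
qed

section \<open>The density of one coordinate under the bimodal prior\<close>

definition bimodal_density :: "real \<Rightarrow> nat \<Rightarrow> real \<Rightarrow> real \<Rightarrow> real \<Rightarrow> real" where
  "bimodal_density v0 a1 a2 w u = (1 - w) * (v0 * u powi (-2) * gdens a1 a2 (v0 * inverse u)) +
     w * (u powi (-2) * gdens a1 a2 (inverse u))"

lemma gdens_measurable [measurable]: "gdens a1 a2 \<in> borel_measurable borel"
  by (simp add: gdens_def[abs_def])

lemma bimodal_density_measurable [measurable]: "bimodal_density v0 a1 a2 w \<in> borel_measurable borel"
  unfolding bimodal_density_def[abs_def] power_int_def by simp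

lemma sets_bimodal_comp [measurable_cong, simp]: "sets (bimodal_comp v0 a1 a2 w) = sets borel"
  by (simp add: bimodal_comp_def)

context
  fixes v0 a2 w :: real and a1 :: nat
  assumes v0: "v0 > 0" and a1: "a1 \<ge> 1" and a2: "a2 > 0" and w: "w \<in> {0..1}"
begin

lemma gdens_nonneg: "t > 0 \<Longrightarrow> 0 \<le> gdens a1 a2 t"
  using a2 by (simp add: gdens_def)

text \<open>The index of \<open>erlang_density\<close> is the shape minus one. The identification
  supplies total mass one for the Gamma density.\<close>

lemma gdens_eq_erlang_density: "t > 0 \<Longrightarrow> gdens a1 a2 t = erlang_density (a1 - 1) a2 t"
  using a1 by (cases a1) (auto simp: gdens_def erlang_density_def)

lemma density_gdens: "density lborel (\<lambda>t. indicator {0<..} t * gdens a1 a2 t) =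
    density lborel (erlang_density (a1 - 1) a2)"
proof (rule density_cong)
  \<comment> \<open>At \<open>t = 0\<close> the two densities can differ, namely for
    \<open>a1 = 1\<close>.\<close>
  have "AE t in lborel. t \<noteq> (0::real)" by (rule AE_lborel_singleton)
  then show "AE t in lborel. ennreal (indicator {0<..} t * gdens a1 a2 t) = erlang_density (a1 - 1) a2 t"
  proof eventually_elim
    case (elim t)
    then show ?case
      by (cases "t > 0") (auto simp: gdens_eq_erlang_density erlang_density_def)
  qed
qed auto

lemma prob_space_gdens: "prob_space (density lborel (\<lambda>t. indicator {0<..} t * gdens a1 a2 t))"
  unfolding density_gdens using a2 by (rule prob_space_erlang_density)

lemma set_integrable_gdens: "set_integrable lborel {0<..} (gdens a1 a2)"
  unfolding set_integrable_def
proof (rule integrableI_nonneg)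
  interpret prob_space "density lborel (\<lambda>t. indicator {0<..} t * gdens a1 a2 t)"
    by (rule prob_space_gdens)
  show "(\<integral>\<^sup>+ t. ennreal (indicat_real {0<..} t *\<^sub>R gdens a1 a2 t) \<partial>lborel) < \<infinity>"
    using emeasure_space_1 by (simp add: emeasure_density)
qed (auto simp: gdens_nonneg indicator_def)

text \<open>The law of \<open>c / T\<close> for a Gamma variable \<open>T\<close>. The cases
  \<open>c = v0\<close> and \<open>c = 1\<close> yield the component densities of the spike and of
  the slab.\<close>

lemma emeasure_reciprocal_gdens:
  assumes c: "c > 0" and [measurable]: "B \<in> sets borel"
  shows "(\<integral>\<^sup>+t. indicator B (c * (1 / t)) * (indicator {0<..} t * gdens a1 a2 t) \<partial>lborel) =
    (\<integral>\<^sup>+u. indicator B u * (indicator {0<..} u * (c * u powi (-2) * gdens a1 a2 (c * inverse u))) \<partial>lborel)"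
proof -
  let ?f = "\<lambda>t. indicator B (c / t) * gdens a1 a2 t :: real"
  have int: "set_integrable lborel {0<..} ?f"
    by (rule set_integrable_bound[OF set_integrable_gdens])
       (auto simp: set_borel_measurable_def indicator_def)
  note sub = set_integral_reciprocal_substitution[OF c int]
  have "(\<integral>\<^sup>+t. indicator B (c * (1 / t)) * (indicator {0<..} t * gdens a1 a2 t) \<partial>lborel) =
     (\<integral>\<^sup>+t. ennreal (indicator {0<..} t *\<^sub>R ?f t) \<partial>lborel)"
    by (intro nn_integral_cong) (auto simp: indicator_def)
  also have "\<dots> = ennreal (LBINT t:{0<..}. ?f t)"
    using int unfolding set_integrable_def set_lebesgue_integral_def
    by (intro nn_integral_eq_integral) (auto simp: indicator_def gdens_nonneg)
  also have "\<dots> = ennreal (LBINT u:{0<..}. c / u\<^sup>2 * ?f (c / u))"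
    by (subst sub(2)) auto
  also have "\<dots> = (\<integral>\<^sup>+u. ennreal (indicator {0<..} u *\<^sub>R (c / u\<^sup>2 * ?f (c / u))) \<partial>lborel)"
    using sub(1) c unfolding set_integrable_def set_lebesgue_integral_def
    by (intro nn_integral_eq_integral[symmetric]) (auto simp: indicator_def gdens_nonneg)
  also have "\<dots> = (\<integral>\<^sup>+u. indicator B u * (indicator {0<..} u * (c * u powi (-2) * gdens a1 a2 (c * inverse u))) \<partial>lborel)"
    using c by (intro nn_integral_cong) (auto simp: indicator_def power_int_minus field_simps)
  finally show ?thesis .
qed

text \<open>Conditioning on the two-valued indicator leaves a mixture, with weights \<open>w\<close>
  and \<open>1 - w\<close>, of two scaled reciprocals of a Gamma variable.\<close>

lemma bimodal_comp_eq_density: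
  "bimodal_comp v0 a1 a2 w = density lborel (\<lambda>u. indicator {0<..} u * bimodal_density v0 a1 a2 w u)"
proof (rule measure_eqI)
  fix B assume "B \<in> sets (bimodal_comp v0 a1 a2 w)"
  then have [measurable]: "B \<in> sets borel" by simp
  let ?G = "density lborel (\<lambda>t. indicator {0<..} t * gdens a1 a2 t)"
  let ?P = "map_pmf (\<lambda>b. if b then 1 else v0) (bernoulli_pmf w)"
  interpret G: prob_space ?G by (rule prob_space_gdens)
  \<comment> \<open>The first factor carries the discrete sigma-algebra, so its projection has to be
    declared measurable into \<open>borel\<close> separately.\<close>
  have [measurable]: "fst \<in> borel_measurable (measure_pmf ?P \<Otimes>\<^sub>M ?G)"
    by (rule measurable_compose[OF measurable_fst]) simp
  have meas: "(\<lambda>(i, t). i * (1 / t)) \<in> borel_measurable (measure_pmf ?P \<Otimes>\<^sub>M ?G)"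
    unfolding case_prod_beta by measurable
  have "emeasure (bimodal_comp v0 a1 a2 w) B =
      (\<integral>\<^sup>+p. indicator B (fst p * (1 / snd p)) \<partial>(measure_pmf ?P \<Otimes>\<^sub>M ?G))"
    unfolding bimodal_comp_def
    by (subst nn_integral_indicator[symmetric], simp, subst nn_integral_distr[OF meas]) (auto simp: case_prod_beta)
  also have "\<dots> = (\<integral>\<^sup>+i. (\<integral>\<^sup>+t. indicator B (i * (1 / t)) \<partial>?G) \<partial>measure_pmf ?P)"
    by (subst G.nn_integral_fst[symmetric]) (auto simp: case_prod_beta)
  also have "\<dots> = (\<integral>\<^sup>+i. (\<integral>\<^sup>+t. indicator B (i * (1 / t)) * (indicator {0<..} t * gdens a1 a2 t) \<partial>lborel) \<partial>measure_pmf ?P)"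
    by (subst nn_integral_density) (auto intro!: nn_integral_cong simp: indicator_def)
  also have "\<dots> = w * (\<integral>\<^sup>+t. indicator B (1 * (1 / t)) * (indicator {0<..} t * gdens a1 a2 t) \<partial>lborel)
     + (1 - w) * (\<integral>\<^sup>+t. indicator B (v0 * (1 / t)) * (indicator {0<..} t * gdens a1 a2 t) \<partial>lborel)"
    using w by (simp add: mult.commute)
  also have "\<dots> = w * (\<integral>\<^sup>+u. indicator B u * (indicator {0<..} u * (1 * u powi (-2) * gdens a1 a2 (1 * inverse u))) \<partial>lborel)
     + (1 - w) * (\<integral>\<^sup>+u. indicator B u * (indicator {0<..} u * (v0 * u powi (-2) * gdens a1 a2 (v0 * inverse u))) \<partial>lborel)"
    using v0 by (subst (1 2) emeasure_reciprocal_gdens) auto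
  also have "\<dots> = (\<integral>\<^sup>+u. indicator B u * (indicator {0<..} u * bimodal_density v0 a1 a2 w u) \<partial>lborel)"
    using w v0 unfolding power_int_def
    by (subst (1 2) nn_integral_cmult[symmetric], simp_all add: nn_integral_add[symmetric])
       (auto intro!: nn_integral_cong simp: indicator_def bimodal_density_def power_int_def
          ennreal_mult[symmetric] gdens_nonneg simp flip: ennreal_plus)
  also have "\<dots> = emeasure (density lborel (\<lambda>u. indicator {0<..} u * bimodal_density v0 a1 a2 w u)) B"
    by (subst emeasure_density) (auto intro!: nn_integral_cong simp: indicator_def)
  finally show "emeasure (bimodal_comp v0 a1 a2 w) B = \<dots>" .
qed simp

lemma bimodal_density_nonneg: "u > 0 \<Longrightarrow> 0 \<le> bimodal_density v0 a1 a2 w u"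
  using v0 w by (auto simp: bimodal_density_def intro!: add_nonneg_nonneg mult_nonneg_nonneg gdens_nonneg)

lemma prob_space_bimodal_comp: "prob_space (bimodal_comp v0 a1 a2 w)"
proof -
  let ?G = "density lborel (\<lambda>t. indicator {0<..} t * gdens a1 a2 t)"
  let ?P = "map_pmf (\<lambda>b. if b then 1 else v0) (bernoulli_pmf w)"
  interpret G: prob_space ?G by (rule prob_space_gdens)
  interpret pair_prob_space "measure_pmf ?P" ?G ..
  have [measurable]: "fst \<in> borel_measurable (measure_pmf ?P \<Otimes>\<^sub>M ?G)"
    by (rule measurable_compose[OF measurable_fst]) simp
  show ?thesis
    unfolding bimodal_comp_def case_prod_beta by (rule prob_space_distr) measurable
qed

lemma AE_bimodal_comp_pos: "AE u in bimodal_comp v0 a1 a2 w. 0 < u"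
  unfolding bimodal_comp_eq_density by (subst AE_density) (auto simp: indicator_def)

lemma integral_bimodal_comp:
  assumes [measurable]: "f \<in> borel_measurable borel"
  shows "(\<integral>u. f u \<partial>bimodal_comp v0 a1 a2 w) =
    (\<integral>u. indicator {0<..} u * (f u * bimodal_density v0 a1 a2 w u) \<partial>lborel)"
  unfolding bimodal_comp_eq_density
  by (subst integral_density) (auto simp: indicator_def bimodal_density_nonneg mult_ac intro!: Bochner_Integration.integral_cong)

lemma integrable_bimodal_comp_shrinkage_factor:
  "integrable (bimodal_comp v0 a1 a2 w) (shrinkage_factor z)"
proof -
  interpret prob_space "bimodal_comp v0 a1 a2 w" by (rule prob_space_bimodal_comp)
  show ?thesis
  proof (rule integrable_const_bound[where B="exp (z\<^sup>2 / 2)"])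
    show "AE u in bimodal_comp v0 a1 a2 w. norm (shrinkage_factor z u) \<le> exp (z\<^sup>2 / 2)"
      using AE_bimodal_comp_pos
    proof eventually_elim
      case (elim u)
      then show ?case using shrinkage_factor_le_exp[of u z] shrinkage_factor_pos[of u z] by simp
    qed
  qed simp
qed

text \<open>Makes the normalising integrals of the other coordinates nonzero, so that they can be
  cancelled.\<close>

lemma integral_bimodal_comp_shrinkage_factor_pos:
  "0 < (\<integral>u. shrinkage_factor z u \<partial>bimodal_comp v0 a1 a2 w)"
proof -
  interpret prob_space "bimodal_comp v0 a1 a2 w" by (rule prob_space_bimodal_comp)
  have pos: "AE u in bimodal_comp v0 a1 a2 w. 0 < shrinkage_factor z u"
    using AE_bimodal_comp_pos by eventually_elim (simp add: shrinkage_factor_pos)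
  have "(\<integral>u. 0 \<partial>bimodal_comp v0 a1 a2 w) < (\<integral>u. shrinkage_factor z u \<partial>bimodal_comp v0 a1 a2 w)"
    using pos by (intro integral_less_AE_space integrable_bimodal_comp_shrinkage_factor)
      (auto simp: emeasure_space_1)
  then show ?thesis by simp
qed

text \<open>Given \<open>w\<close> both the prior and the likelihood are products over the
  coordinates, and the event concerns coordinate \<open>k\<close> only. Numerator and denominator
  therefore share the likelihood constant and the integrals of all other coordinates.\<close>

lemma posterior_bimodal_prior:
  fixes y :: "nat \<Rightarrow> real"
  assumes x: "orthogonal_design K n x" and k: "k < K" and [measurable]: "B \<in> sets borel"
  defines "\<pi> \<equiv> bimodal_prior_given_w K v0 a1 a2 w" and "z \<equiv> (\<lambda>k. (\<Sum>i<n. x i k * y i) / n)"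
  shows "posterior \<pi> (ss_lik K n x n y) {\<gamma> \<in> space \<pi>. \<gamma> k \<in> B} =
    (\<integral>u. indicator B u * shrinkage_factor (z k) u \<partial>bimodal_comp v0 a1 a2 w) /
    (\<integral>u. shrinkage_factor (z k) u \<partial>bimodal_comp v0 a1 a2 w)"
proof -
  let ?m = "bimodal_comp v0 a1 a2 w"
  interpret C: prob_space ?m by (rule prob_space_bimodal_comp)
  interpret product_prob_space "\<lambda>_::nat. ?m" "{..<K}" by standard
  have n: "n > 0" using x by (auto simp: orthogonal_design_def)
  define C where "C = (\<Prod>i<n. normal_density 0 (sqrt n) (y i))"
  have "C > 0" unfolding C_def using n by (intro prod_pos) (auto intro: normal_density_pos)
  have \<pi>: "\<pi> = (\<Pi>\<^sub>M k\<in>{..<K}. ?m)" by (simp add: \<pi>_def bimodal_prior_given_w_def)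
  have [measurable_cong]: "sets \<pi> = sets (\<Pi>\<^sub>M k\<in>{..<K}. borel)"
    unfolding \<pi> by (intro sets_PiM_cong) auto
  have pos: "AE \<gamma> in \<pi>. \<forall>k<K. 0 < \<gamma> k"
  proof -
    have "AE \<gamma> in \<pi>. 0 < \<gamma> k" if "k < K" for k
      unfolding \<pi> using that AE_bimodal_comp_pos by (intro AE_component) auto
    then have "AE \<gamma> in \<pi>. \<forall>k\<in>{..<K}. 0 < \<gamma> k" by (subst AE_finite_all) auto
    then show ?thesis by eventually_elim auto
  qed
  \<comment> \<open>Stated for an arbitrary set \<open>A\<close>: the numerator is the case
    \<open>A = B\<close>, the normalising constant the case \<open>A = UNIV\<close>.\<close>
  have int: "(\<integral>\<gamma>. indicator {\<gamma> \<in> space \<pi>. \<gamma> k \<in> A} \<gamma> * ss_lik K n x n y \<gamma> \<partial>\<pi>) =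
      C * ((\<integral>u. indicator A u * shrinkage_factor (z k) u \<partial>?m) *
        (\<Prod>l\<in>{..<K} - {k}. \<integral>u. shrinkage_factor (z l) u \<partial>?m))"
    if [measurable]: "A \<in> sets borel" for A
  proof -
    let ?g = "\<lambda>l u. (if l = k then indicator A u else 1) * shrinkage_factor (z l) u"
    have int_g: "integrable ?m (?g l)" for l
    proof (rule Bochner_Integration.integrable_bound[OF integrable_bimodal_comp_shrinkage_factor[of "z l"]])
      show "?g l \<in> borel_measurable ?m" by (cases "l = k") simp_all
      show "AE u in ?m. norm (?g l u) \<le> norm (shrinkage_factor (z l) u)"
        by (intro AE_I2) (simp add: indicator_def)
    qed
    have [measurable]: "(\<lambda>\<gamma>. \<gamma> l) \<in> borel_measurable \<pi>" if "l < K" for l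
      using that measurable_component_singleton[of l "{..<K}" "\<lambda>_. ?m"]
      by (simp add: \<pi> cong: measurable_cong_sets)
    have "(\<integral>\<gamma>. indicator {\<gamma> \<in> space \<pi>. \<gamma> k \<in> A} \<gamma> * ss_lik K n x n y \<gamma> \<partial>\<pi>) =
       (\<integral>\<gamma>. C * (\<Prod>l<K. ?g l (\<gamma> l)) \<partial>\<pi>)"
    proof (rule integral_cong_AE)
      show "AE \<gamma> in \<pi>. indicator {\<gamma> \<in> space \<pi>. \<gamma> k \<in> A} \<gamma> * ss_lik K n x n y \<gamma> =
         C * (\<Prod>l<K. ?g l (\<gamma> l))"
        using pos AE_space
      proof eventually_elim
        case (elim \<gamma>)
        have "(\<Prod>l<K. if l = k then indicator A (\<gamma> l) else 1) = (indicator A (\<gamma> k) :: real)"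
          using k by (subst prod.delta) auto
        with elim show ?case
          by (simp add: ss_lik_orthogonal_design[OF x] C_def z_def prod.distrib) (simp add: indicator_def)
      qed
    qed (use k in measurable)
    also have "(\<integral>\<gamma>. C * (\<Prod>l<K. ?g l (\<gamma> l)) \<partial>\<pi>) = C * (\<Prod>l<K. \<integral>u. ?g l u \<partial>?m)"
      unfolding \<pi>
      by (subst Bochner_Integration.integral_mult_right_zero, subst product_integral_prod)
        (auto intro!: int_g)
    also have "(\<Prod>l<K. \<integral>u. ?g l u \<partial>?m) = (\<integral>u. indicator A u * shrinkage_factor (z k) u \<partial>?m) *
        (\<Prod>l\<in>{..<K} - {k}. \<integral>u. shrinkage_factor (z l) u \<partial>?m)"
      using k by (subst prod.remove[of _ k]) auto
    finally show ?thesis .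
  qed
  have full: "(\<integral>\<gamma>. ss_lik K n x n y \<gamma> \<partial>\<pi>) =
      C * ((\<integral>u. shrinkage_factor (z k) u \<partial>?m) *
        (\<Prod>l\<in>{..<K} - {k}. \<integral>u. shrinkage_factor (z l) u \<partial>?m))"
    using int[of UNIV] by (simp cong: Bochner_Integration.integral_cong)
  define R where "R = (\<Prod>l\<in>{..<K} - {k}. \<integral>u. shrinkage_factor (z l) u \<partial>?m)"
  have "R > 0"
    unfolding R_def by (intro prod_pos ballI integral_bimodal_comp_shrinkage_factor_pos)
  with \<open>C > 0\<close> show ?thesis
    unfolding posterior_def full int[OF \<open>B \<in> sets borel\<close>] R_def[symmetric] by simp
qed

end

section \<open>Posterior under a general prior\<close>

text \<open>The deviation from 1 is the posterior mass of the complement,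
  \<open>I2 / (I1 + I2)\<close>. The numerator is bounded pointwise, where coordinate
  \<open>k\<close> loses the fraction \<open>\<delta>\<close> of its exponent; the denominator is at
  least its part over the box from \<open>T\<close> to \<open>U\<close>, which has prior mass
  \<open>p\<close>.\<close>

lemma abs_posterior_minus_1_le:
  fixes y :: "nat \<Rightarrow> real" and \<pi> :: "(nat \<Rightarrow> real) measure"
  assumes x: "orthogonal_design K n x" and \<pi>: "prob_space \<pi>"
    and sets [measurable_cong]: "sets \<pi> = sets (\<Pi>\<^sub>M k\<in>{..<K}. (borel :: real measure))"
    and pos: "AE \<gamma> in \<pi>. \<forall>k<K. 0 < \<gamma> k"
    and k: "k < K" and \<delta>: "0 < \<delta>" "\<delta> < 1" and T: "0 \<le> T"
    and p: "p = measure \<pi> {\<gamma> \<in> space \<pi>. \<forall>l<K. T \<le> \<gamma> l \<and> \<gamma> l \<le> U}" "p > 0"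
  defines "z \<equiv> (\<lambda>k. (\<Sum>i<n. x i k * y i) / n)"
  shows "\<bar>posterior \<pi> (ss_lik K n x n y) {\<gamma> \<in> space \<pi>. \<gamma> k / (1 + \<gamma> k) > 1 - \<delta>} - 1\<bar>
    \<le> exp (((\<Sum>l<K. (z l)\<^sup>2) / (1 + T) - \<delta> * (z k)\<^sup>2) / 2) / (p * ((1 + U) powr (-1/2)) ^ K)"
proof -
  interpret prob_space \<pi> by fact
  have n: "n > 0" using x by (auto simp: orthogonal_design_def)
  have comp [measurable]: "(\<lambda>\<gamma>. \<gamma> l) \<in> borel_measurable \<pi>" if "l < K" for l
    using that measurable_component_singleton[of l "{..<K}" "\<lambda>_. borel :: real measure"]
    by (simp cong: measurable_cong_sets add: sets)
  define C where "C = (\<Prod>i<n. normal_density 0 (sqrt n) (y i))"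
  have C: "C > 0" unfolding C_def using n by (intro prod_pos) (auto intro: normal_density_pos)
  define L where "L = ss_lik K n x n y"
  define Z where "Z = (\<Sum>l<K. (z l)\<^sup>2)"
  define D where "D = ((1 + U) powr (-1/2)) ^ K"
  define A where "A = {\<gamma> \<in> space \<pi>. \<gamma> k / (1 + \<gamma> k) > 1 - \<delta>}"
  define E where "E = {\<gamma> \<in> space \<pi>. \<forall>l<K. T \<le> \<gamma> l \<and> \<gamma> l \<le> U}"
  have Lm [measurable]: "L \<in> borel_measurable \<pi>"
    unfolding L_def using ss_lik_measurable by (simp cong: measurable_cong_sets add: sets)
  have Am [measurable]: "A \<in> sets \<pi>"
    unfolding A_def using k by measurable
  have Em [measurable]: "E \<in> sets \<pi>"
    unfolding E_def by measurable
  \<comment> \<open>The box has positive mass, hence is nonempty, and any of its points has a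
    coordinate \<open>k\<close> between \<open>T\<close> and \<open>U\<close>.\<close>
  have U: "0 \<le> U"
  proof -
    have "p = prob E" using p by (simp add: E_def)
    then have "E \<noteq> {}" using p by auto
    then show ?thesis using k T by (force simp: E_def)
  qed
  have D: "D > 0" using U by (simp add: D_def)
  have L: "AE \<gamma> in \<pi>. (\<forall>l<K. 0 < \<gamma> l) \<and> L \<gamma> = C * (\<Prod>l<K. shrinkage_factor (z l) (\<gamma> l))"
    using pos by eventually_elim (simp add: L_def C_def z_def ss_lik_orthogonal_design[OF x])
  have L0: "AE \<gamma> in \<pi>. 0 \<le> L \<gamma>"
    using L
  proof eventually_elim
    case (elim \<gamma>)
    then show ?case
      using C by (auto intro!: mult_nonneg_nonneg prod_nonneg less_imp_le[OF shrinkage_factor_pos] simp: less_trans[of "-1" 0])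
  qed
  have up: "AE \<gamma> in \<pi>. L \<gamma> \<le> C * exp (Z / 2)"
    using L
  proof eventually_elim
    case (elim \<gamma>)
    have "(\<Prod>l<K. shrinkage_factor (z l) (\<gamma> l)) \<le> (\<Prod>l<K. exp ((z l)\<^sup>2 / 2))"
      using elim by (intro prod_mono) (auto intro!: shrinkage_factor_le_exp less_imp_le[OF shrinkage_factor_pos] simp: less_trans[of "-1" 0] less_imp_le)
    also have "\<dots> = exp (Z / 2)" by (simp add: exp_sum[symmetric] Z_def sum_divide_distrib)
    finally show ?case using elim C by simp
  qed
  have upA: "AE \<gamma> in \<pi>. indicator (space \<pi> - A) \<gamma> * L \<gamma> \<le> C * exp ((Z - \<delta> * (z k)\<^sup>2) / 2)"
    using L AE_space
  proof eventually_elim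
    case (elim \<gamma>)
    show ?case
    proof (cases "\<gamma> \<in> A")
      case False
      \<comment> \<open>Off \<open>A\<close> the shrinkage weight is at most
        \<open>1 - \<delta>\<close> in coordinate \<open>k\<close>; in the others only the trivial
        bound 1 is available.\<close>
      let ?c = "\<lambda>l. if l = k then 1 - \<delta> else 1"
      have c: "\<gamma> l / (1 + \<gamma> l) \<le> ?c l" if "l < K" for l
        using False elim that by (auto simp: A_def field_simps)
      have "shrinkage_factor (z l) (\<gamma> l) \<le> exp (?c l * (z l)\<^sup>2 / 2)" if "l < K" for l
        using elim that by (intro shrinkage_factor_le c) (auto simp: less_imp_le)
      then have "(\<Prod>l<K. shrinkage_factor (z l) (\<gamma> l)) \<le> (\<Prod>l<K. exp (?c l * (z l)\<^sup>2 / 2))"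
        using elim by (intro prod_mono) (auto intro!: less_imp_le[OF shrinkage_factor_pos] simp: less_trans[of "-1" 0])
      also have "\<dots> = exp (\<Sum>l<K. ?c l * (z l)\<^sup>2 / 2)" by (simp add: exp_sum)
      also have "(\<Sum>l<K. ?c l * (z l)\<^sup>2 / 2) = (\<Sum>l<K. (z l)\<^sup>2 / 2 - (if l = k then \<delta> * (z k)\<^sup>2 / 2 else 0))"
        by (intro sum.cong) (auto simp: field_simps)
      also have "\<dots> = (Z - \<delta> * (z k)\<^sup>2) / 2"
        using k by (simp add: sum_subtractf Z_def sum_divide_distrib diff_divide_distrib)
      finally show ?thesis using elim C False by simp
    qed (use C in auto)
  qed
  have low: "AE \<gamma> in \<pi>. indicator E \<gamma> * (C * (exp (T / (1 + T) * Z / 2) * D)) \<le> L \<gamma>"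
    using L L0
  proof eventually_elim
    case (elim \<gamma>)
    show ?case
    proof (cases "\<gamma> \<in> E")
      case True
      have "exp (T / (1 + T) * Z / 2) * D = (\<Prod>l<K. exp (T / (1 + T) * (z l)\<^sup>2 / 2) * (1 + U) powr (-1/2))"
        by (simp add: prod.distrib exp_sum[symmetric] Z_def D_def sum_divide_distrib sum_distrib_left)
      also have "\<dots> \<le> (\<Prod>l<K. shrinkage_factor (z l) (\<gamma> l))"
        using True T by (intro prod_mono conjI shrinkage_factor_ge) (auto simp: E_def)
      finally show ?thesis using elim C True by simp
    qed (use elim in auto)
  qed
  have Lint: "integrable \<pi> L"
    by (rule integrable_const_bound[where B="C * exp (Z / 2)"]) (use L0 up in \<open>auto elim: eventually_elim2\<close>)
  have iA: "integrable \<pi> (\<lambda>\<gamma>. indicator A \<gamma> * L \<gamma>)" "integrable \<pi> (\<lambda>\<gamma>. indicator (space \<pi> - A) \<gamma> * L \<gamma>)"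
    using integrable_mult_indicator[OF _ Lint] by (auto simp: Am)
  define I1 where "I1 = (\<integral>\<gamma>. indicator A \<gamma> * L \<gamma> \<partial>\<pi>)"
  define I2 where "I2 = (\<integral>\<gamma>. indicator (space \<pi> - A) \<gamma> * L \<gamma> \<partial>\<pi>)"
  have sum: "(\<integral>\<gamma>. L \<gamma> \<partial>\<pi>) = I1 + I2"
  proof -
    have "(\<integral>\<gamma>. L \<gamma> \<partial>\<pi>) = (\<integral>\<gamma>. indicator A \<gamma> * L \<gamma> + indicator (space \<pi> - A) \<gamma> * L \<gamma> \<partial>\<pi>)"
      by (intro Bochner_Integration.integral_cong) (auto split: split_indicator)
    then show ?thesis
      unfolding I1_def I2_def by (simp only: Bochner_Integration.integral_add[OF iA])
  qed
  have I2: "0 \<le> I2" "I2 \<le> C * exp ((Z - \<delta> * (z k)\<^sup>2) / 2)"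
  proof -
    show "0 \<le> I2" unfolding I2_def
      by (rule integral_nonneg_AE) (use L0 in \<open>auto simp: indicator_def\<close>)
    have "I2 \<le> (\<integral>\<gamma>. C * exp ((Z - \<delta> * (z k)\<^sup>2) / 2) \<partial>\<pi>)"
      unfolding I2_def by (rule integral_mono_AE[OF iA(2) _ upA]) simp
    then show "I2 \<le> C * exp ((Z - \<delta> * (z k)\<^sup>2) / 2)" by (simp add: prob_space)
  qed
  have I: "p * (C * (exp (T / (1 + T) * Z / 2) * D)) \<le> I1 + I2"
  proof -
    have "(\<integral>\<gamma>. indicator E \<gamma> * (C * (exp (T / (1 + T) * Z / 2) * D)) \<partial>\<pi>) \<le> (\<integral>\<gamma>. L \<gamma> \<partial>\<pi>)"
      by (rule integral_mono_AE[OF _ Lint low]) (simp add: emeasure_eq_measure less_top[symmetric])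
    moreover have "p = prob E" using p by (simp add: E_def)
    ultimately show ?thesis by (simp add: sum)
  qed
  have I0: "0 < p * (C * (exp (T / (1 + T) * Z / 2) * D))" using p C D by simp
  have "\<bar>I1 / (I1 + I2) - 1\<bar> = I2 / (I1 + I2)"
  proof -
    have "I1 / (I1 + I2) - 1 = - (I2 / (I1 + I2))" using I I0 by (simp add: field_simps)
    then show ?thesis using I I0 I2 by simp
  qed
  also have "\<dots> \<le> (C * exp ((Z - \<delta> * (z k)\<^sup>2) / 2)) / (p * (C * (exp (T / (1 + T) * Z / 2) * D)))"
    using I I0 I2 by (intro frac_le) auto
  also have "\<dots> = exp ((Z - \<delta> * (z k)\<^sup>2) / 2) / exp (T / (1 + T) * Z / 2) / (p * D)"
    using C by simp
  \<comment> \<open>Since \<open>1 - T / (1 + T) = 1 / (1 + T)\<close>, the full exponent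
    \<open>Z\<close> shrinks to \<open>Z / (1 + T)\<close>, which is small for large
    \<open>T\<close>.\<close>
  also have "exp ((Z - \<delta> * (z k)\<^sup>2) / 2) / exp (T / (1 + T) * Z / 2) = exp ((Z / (1 + T) - \<delta> * (z k)\<^sup>2) / 2)"
  proof -
    have "(Z - \<delta> * (z k)\<^sup>2) / 2 - T / (1 + T) * Z / 2 = (Z / (1 + T) - \<delta> * (z k)\<^sup>2) / 2"
      using T by (simp add: field_simps)
    then show ?thesis by (simp only: exp_diff[symmetric])
  qed
  finally show ?thesis
    unfolding posterior_def sum[unfolded L_def] I1_def[unfolded A_def L_def, symmetric] Z_def D_def .
qed

section \<open>Sums of independent random variables\<close>

text \<open>Induction on the index set: a new summand is independent of the partial sum and centred,
  so the cross term has expectation zero. Integrability is carried along because the next induction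
  step and Chebyshev's inequality rely on it.\<close>

lemma (in prob_space) indep_sum_second_moment:
  fixes Z :: "'i \<Rightarrow> 'a \<Rightarrow> real"
  assumes "finite I" and "indep_vars (\<lambda>_. borel) Z I"
    and "\<And>i. i \<in> I \<Longrightarrow> integrable M (\<lambda>\<omega>. (Z i \<omega>)\<^sup>2)"
    and "\<And>i. i \<in> I \<Longrightarrow> expectation (Z i) = 0"
  shows "integrable M (\<lambda>\<omega>. (\<Sum>i\<in>I. Z i \<omega>)\<^sup>2) \<and>
    expectation (\<lambda>\<omega>. (\<Sum>i\<in>I. Z i \<omega>)\<^sup>2) = (\<Sum>i\<in>I. expectation (\<lambda>\<omega>. (Z i \<omega>)\<^sup>2))"
  using assms
proof (induction I rule: finite_induct)
  case (insert j F)
  have rv: "Z i \<in> borel_measurable M" if "i \<in> insert j F" for i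
    using insert.prems(1) that by (auto simp: indep_vars_def2)
  have F: "indep_vars (\<lambda>_. borel) Z F"
    using insert.prems(1) by (rule indep_vars_subset) auto
  have IH: "integrable M (\<lambda>\<omega>. (\<Sum>i\<in>F. Z i \<omega>)\<^sup>2)"
    "expectation (\<lambda>\<omega>. (\<Sum>i\<in>F. Z i \<omega>)\<^sup>2) = (\<Sum>i\<in>F. expectation (\<lambda>\<omega>. (Z i \<omega>)\<^sup>2))"
    using insert.IH[OF F] insert.prems by auto
  have int: "integrable M (Z i)" if "i \<in> insert j F" for i
    by (rule square_integrable_imp_integrable[OF rv insert.prems(2)]) (use that in auto)
  have ind: "indep_var borel (Z j) borel (\<lambda>\<omega>. \<Sum>i\<in>F. Z i \<omega>)"
    using insert by (intro indep_vars_sum) auto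
  have intS: "integrable M (\<lambda>\<omega>. \<Sum>i\<in>F. Z i \<omega>)"
    using int by auto
  have cross: "integrable M (\<lambda>\<omega>. Z j \<omega> * (\<Sum>i\<in>F. Z i \<omega>))"
    "expectation (\<lambda>\<omega>. Z j \<omega> * (\<Sum>i\<in>F. Z i \<omega>)) = 0"
    using indep_var_integrable[OF ind int intS] indep_var_lebesgue_integral[OF ind int intS]
      insert.prems(3) by auto
  have eq: "(\<Sum>i\<in>insert j F. Z i \<omega>)\<^sup>2 = (Z j \<omega>)\<^sup>2 + 2 * (Z j \<omega> * (\<Sum>i\<in>F. Z i \<omega>)) + (\<Sum>i\<in>F. Z i \<omega>)\<^sup>2" for \<omega>
    using insert.hyps by (simp add: power2_sum)
  show ?case
    unfolding eq using insert.prems(2) insert.hyps cross IH by simp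
qed simp

lemma (in prob_space) Chebyshev_indep_sum:
  fixes Z :: "'i \<Rightarrow> 'a \<Rightarrow> real"
  assumes I: "finite I" and ind: "indep_vars (\<lambda>_. borel) Z I"
    and sq: "\<And>i. i \<in> I \<Longrightarrow> integrable M (\<lambda>\<omega>. (Z i \<omega>)\<^sup>2)"
    and mean: "\<And>i. i \<in> I \<Longrightarrow> expectation (Z i) = 0" and a: "a > 0"
  shows "prob {\<omega> \<in> space M. a \<le> \<bar>\<Sum>i\<in>I. Z i \<omega>\<bar>} \<le> (\<Sum>i\<in>I. expectation (\<lambda>\<omega>. (Z i \<omega>)\<^sup>2)) / a\<^sup>2"
proof -
  have rv [measurable]: "Z i \<in> borel_measurable M" if "i \<in> I" for i
    using ind that by (simp add: indep_vars_def2)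
  have int: "integrable M (Z i)" if "i \<in> I" for i
    by (rule square_integrable_imp_integrable[OF rv sq]) (use that in auto)
  have E: "expectation (\<lambda>\<omega>. \<Sum>i\<in>I. Z i \<omega>) = 0"
    using int mean by simp
  note m = indep_sum_second_moment[OF I ind sq mean]
  show ?thesis
    using Chebyshev_inequality[of "\<lambda>\<omega>. \<Sum>i\<in>I. Z i \<omega>" a] m a
    by (simp add: E)
qed

section \<open>Lyapunov's and Slutsky's theorems on characteristic functions\<close>

lemma abs_exp_minus_le_square:
  fixes x :: real
  assumes "x \<ge> 0"
  shows "\<bar>exp (- x) - (1 - x)\<bar> \<le> x\<^sup>2"
proof -
  have "exp (- x) \<le> 1 / (1 + x)"
    using exp_ge_add_one_self[of x] assms by (simp add: exp_minus field_simps)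
  also have "\<dots> \<le> 1 - x + x\<^sup>2"
    using assms by (simp add: field_simps power2_eq_square)
  finally show ?thesis using exp_ge_add_one_self[of "- x"] by simp
qed

text \<open>Each factor of the characteristic function is compared with that of a centred normal of
  the same variance. The error of one factor is at most a small multiple of its squared weight, and
  the squared weights sum to \<open>1 / \<sigma>\<^sup>2\<close>, so the total error is governed by
  the largest weight.\<close>

lemma (in prob_space) Lyapunov_char_tendsto:
  fixes Z :: "nat \<Rightarrow> 'a \<Rightarrow> real" and a :: "nat \<Rightarrow> nat \<Rightarrow> real"
  assumes ind: "indep_vars (\<lambda>_. borel) Z UNIV"
    and mean: "\<And>i. expectation (Z i) = 0"
    and int4: "\<And>i. integrable M (\<lambda>\<omega>. (Z i \<omega>) ^ 4)"
    and var: "\<And>i. expectation (\<lambda>\<omega>. (Z i \<omega>)\<^sup>2) = \<sigma>\<^sup>2" and \<sigma>: "\<sigma> > 0"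
    and fourth: "\<And>i. expectation (\<lambda>\<omega>. (Z i \<omega>) ^ 4) \<le> B"
    and a2: "\<forall>\<^sub>F n in sequentially. (\<Sum>i<n. (a n i)\<^sup>2) = 1 / \<sigma>\<^sup>2"
    and am: "\<forall>\<^sub>F n in sequentially. \<forall>i<n. \<bar>a n i\<bar> \<le> m n" and m: "m \<longlonglongrightarrow> 0"
  shows "(\<lambda>n. char (distr M borel (\<lambda>\<omega>. \<Sum>i<n. a n i * Z i \<omega>)) t) \<longlonglongrightarrow> exp (- t\<^sup>2 / 2)"
proof -
  have rv [measurable]: "Z i \<in> borel_measurable M" for i
    using ind by (simp add: indep_vars_def2)
  have int2: "integrable M (\<lambda>\<omega>. (Z i \<omega>)\<^sup>2)" for i
    using int4[of i] by - (rule square_integrable_imp_integrable, auto simp: power2_eq_square power4_eq_xxxx mult.assoc)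
  have int1: "integrable M (Z i)" for i
    by (rule square_integrable_imp_integrable[OF rv int2])
  \<comment> \<open>Controls the third absolute moment by the second and fourth; after division by
    \<open>r\<^sup>2\<close> it says that \<open>1 - q + q\<^sup>2\<close> is nonnegative.\<close>
  have cube: "\<bar>r\<bar> ^ 3 \<le> r\<^sup>2 + r ^ 4" for r :: real
  proof -
    define q where "q = \<bar>r\<bar>"
    have "0 \<le> 1 - q + q\<^sup>2"
      using zero_le_power2[of "q - 1 / 2"] by (simp add: power2_eq_square field_simps)
    then have "0 \<le> q\<^sup>2 * (1 - q + q\<^sup>2)" by simp
    also have "\<dots> = q\<^sup>2 - q ^ 3 + q ^ 4"
      by (simp add: algebra_simps power2_eq_square power3_eq_cube power4_eq_xxxx)
    finally have "q ^ 3 \<le> q\<^sup>2 + q ^ 4" by simp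
    then show ?thesis by (simp add: q_def power_even_abs)
  qed
  \<comment> \<open>The constant \<open>b\<close> comes from the third-order Taylor error of a
    characteristic function, \<open>c\<close> from replacing \<open>1 - x\<close> by
    \<open>exp (- x)\<close> at
    \<open>x = t\<^sup>2 * r\<^sup>2 * \<sigma>\<^sup>2 / 2\<close>.\<close>
  define b where "b = \<bar>t\<bar> ^ 3 / 6 * (\<sigma>\<^sup>2 + B)"
  define c where "c = (t\<^sup>2 * \<sigma>\<^sup>2 / 2)\<^sup>2"
  have b: "b \<ge> 0"
  proof -
    have "0 \<le> expectation (\<lambda>\<omega>. (Z 0 \<omega>) ^ 4)" by simp
    then have "0 \<le> B" using fourth[of 0] by linarith
    then show ?thesis by (simp add: b_def)
  qed
  have single: "cmod (char (distr M borel (\<lambda>\<omega>. r * Z i \<omega>)) t - exp (- (t\<^sup>2 * r\<^sup>2 * \<sigma>\<^sup>2 / 2)))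
      \<le> (b * \<bar>r\<bar> + c * r\<^sup>2) * r\<^sup>2" for r i
  proof -
    let ?\<phi> = "char (distr M borel (\<lambda>\<omega>. r * Z i \<omega>)) t"
    have "cmod (?\<phi> - (1 - t\<^sup>2 * (r\<^sup>2 * \<sigma>\<^sup>2) / 2)) \<le>
      (t\<^sup>2 / 6) * expectation (\<lambda>\<omega>. min (6 * (r * Z i \<omega>)\<^sup>2) (\<bar>t\<bar> * \<bar>r * Z i \<omega>\<bar>^3))"
      by (rule char_approx3') (auto simp: int1 int2 mean var power_mult_distrib)
    also have "\<dots> \<le> (t\<^sup>2 / 6) * expectation (\<lambda>\<omega>. \<bar>t\<bar> * \<bar>r\<bar>^3 * ((Z i \<omega>)\<^sup>2 + (Z i \<omega>)^4))"
    proof (intro mult_left_mono integral_mono_AE')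
      show "integrable M (\<lambda>\<omega>. \<bar>t\<bar> * \<bar>r\<bar>^3 * ((Z i \<omega>)\<^sup>2 + (Z i \<omega>)^4))"
        using int2 int4 by simp
      show "AE \<omega> in M. min (6 * (r * Z i \<omega>)\<^sup>2) (\<bar>t\<bar> * \<bar>r * Z i \<omega>\<bar>^3) \<le> \<bar>t\<bar> * \<bar>r\<bar>^3 * ((Z i \<omega>)\<^sup>2 + (Z i \<omega>)^4)"
        by (intro AE_I2 min.coboundedI2)
           (auto simp: abs_mult power_mult_distrib mult.assoc intro!: mult_left_mono cube)
      show "AE \<omega> in M. 0 \<le> \<bar>t\<bar> * \<bar>r\<bar>^3 * ((Z i \<omega>)\<^sup>2 + (Z i \<omega>)^4)"
        by (intro AE_I2) simp
    qed simp
    also have "\<dots> = (t\<^sup>2 / 6) * (\<bar>t\<bar> * \<bar>r\<bar>^3 * (\<sigma>\<^sup>2 + expectation (\<lambda>\<omega>. (Z i \<omega>)^4)))"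
      using int2 int4 by (simp add: var)
    also have "\<dots> \<le> (t\<^sup>2 / 6) * (\<bar>t\<bar> * \<bar>r\<bar>^3 * (\<sigma>\<^sup>2 + B))"
      using fourth[of i] by (intro mult_left_mono) auto
    also have "\<dots> = b * \<bar>r\<bar> * r\<^sup>2"
    proof -
      have "\<bar>t\<bar> ^ 3 = t\<^sup>2 * \<bar>t\<bar>" "\<bar>r\<bar> ^ 3 = r\<^sup>2 * \<bar>r\<bar>"
        by (simp_all add: power3_eq_cube power2_eq_square)
      then show ?thesis by (simp add: b_def mult_ac)
    qed
    finally have 1: "cmod (?\<phi> - (1 - t\<^sup>2 * (r\<^sup>2 * \<sigma>\<^sup>2) / 2)) \<le> b * \<bar>r\<bar> * r\<^sup>2" .
    let ?x = "t\<^sup>2 * r\<^sup>2 * \<sigma>\<^sup>2 / 2"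
    have "cmod (complex_of_real (1 - ?x) - complex_of_real (exp (- ?x))) = \<bar>exp (- ?x) - (1 - ?x)\<bar>"
      by (subst of_real_diff[symmetric], subst norm_of_real) simp
    also have "\<dots> \<le> ?x\<^sup>2" by (rule abs_exp_minus_le_square) simp
    also have "\<dots> = c * r\<^sup>2 * r\<^sup>2" by (simp add: c_def power2_eq_square)
    finally have 2: "cmod (complex_of_real (1 - ?x) - complex_of_real (exp (- ?x))) \<le> c * r\<^sup>2 * r\<^sup>2" .
    have "cmod (?\<phi> - exp (- ?x)) \<le> cmod (?\<phi> - complex_of_real (1 - ?x)) + cmod (complex_of_real (1 - ?x) - exp (- ?x))"
      using norm_triangle_ineq[of "?\<phi> - complex_of_real (1 - ?x)" "complex_of_real (1 - ?x) - exp (- ?x)"] by simp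
    with 1 2 show ?thesis by (simp add: distrib_right mult.assoc)
  qed
  have bound: "\<forall>\<^sub>F n in sequentially. cmod (char (distr M borel (\<lambda>\<omega>. \<Sum>i<n. a n i * Z i \<omega>)) t - exp (- t\<^sup>2 / 2))
      \<le> (b * m n + c * (m n)\<^sup>2) / \<sigma>\<^sup>2"
    using a2 am
  proof eventually_elim
    case (elim n)
    let ?w = "\<lambda>i. complex_of_real (exp (- (t\<^sup>2 * (a n i)\<^sup>2 * \<sigma>\<^sup>2 / 2)))"
    let ?\<phi> = "\<lambda>i. char (distr M borel (\<lambda>\<omega>. a n i * Z i \<omega>)) t"
    have "char (distr M borel (\<lambda>\<omega>. \<Sum>i<n. a n i * Z i \<omega>)) t = (\<Prod>i<n. ?\<phi> i)"
      by (rule char_distr_sum, rule indep_vars_compose2[where X=Z], rule indep_vars_subset[OF ind]) auto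
    \<comment> \<open>The normalisation of the squared weights makes the normal factors multiply
      exactly to the limit.\<close>
    moreover have "complex_of_real (exp (- t\<^sup>2 / 2)) = (\<Prod>i<n. ?w i)"
    proof -
      have "(\<Sum>i<n. - (t\<^sup>2 * (a n i)\<^sup>2 * \<sigma>\<^sup>2 / 2)) = - (t\<^sup>2 / 2 * \<sigma>\<^sup>2 * (\<Sum>i<n. (a n i)\<^sup>2))"
        by (simp add: sum_negf sum_distrib_left mult_ac)
      also have "\<dots> = - t\<^sup>2 / 2" using elim(1) \<sigma> by simp
      finally show ?thesis by (simp flip: exp_sum of_real_prod)
    qed
    \<comment> \<open>All factors lie in the closed unit disc, so the difference of the products
      telescopes into a sum.\<close>
    moreover have "cmod ((\<Prod>i<n. ?\<phi> i) - (\<Prod>i<n. ?w i)) \<le> (\<Sum>i<n. cmod (?\<phi> i - ?w i))"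
      by (intro norm_prod_diff real_distribution.cmod_char_le_1 real_distribution_distr) auto
    moreover have "(\<Sum>i<n. cmod (?\<phi> i - ?w i)) \<le> (\<Sum>i<n. (b * m n + c * (m n)\<^sup>2) * (a n i)\<^sup>2)"
    proof (rule sum_mono)
      fix i assume "i \<in> {..<n}"
      then have i: "\<bar>a n i\<bar> \<le> m n" using elim by auto
      have "cmod (?\<phi> i - ?w i) \<le> (b * \<bar>a n i\<bar> + c * (a n i)\<^sup>2) * (a n i)\<^sup>2" by (rule single)
      also have "\<dots> \<le> (b * m n + c * (m n)\<^sup>2) * (a n i)\<^sup>2"
        using i b by (intro mult_right_mono add_mono mult_left_mono) (auto simp: c_def abs_le_square_iff[symmetric])
      finally show "cmod (?\<phi> i - ?w i) \<le> (b * m n + c * (m n)\<^sup>2) * (a n i)\<^sup>2" .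
    qed
    ultimately show ?case using elim(1) by (simp flip: sum_distrib_left)
  qed
  have "(\<lambda>n. (b * m n + c * (m n)\<^sup>2) / \<sigma>\<^sup>2) \<longlonglongrightarrow> (b * 0 + c * 0\<^sup>2) / \<sigma>\<^sup>2"
    using \<sigma> by (intro tendsto_intros m) auto
  then have "(\<lambda>n. char (distr M borel (\<lambda>\<omega>. \<Sum>i<n. a n i * Z i \<omega>)) t - exp (- t\<^sup>2 / 2)) \<longlonglongrightarrow> 0"
    by (intro Lim_null_comparison[OF bound]) simp
  then show ?thesis by (rule LIM_zero_cancel)
qed

text \<open>The function \<open>iexp (t * x)\<close> has modulus 1 and is Lipschitz in
  \<open>x\<close> with constant \<open>\<bar>t\<bar>\<close>. The characteristic functions thus
  differ by at most \<open>\<bar>t\<bar> * e\<close> plus twice the probability that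
  \<open>U n\<close> and \<open>V n\<close> are at least \<open>e\<close> apart.\<close>

lemma (in prob_space) char_tendsto_diff_in_prob:
  fixes U V :: "nat \<Rightarrow> 'a \<Rightarrow> real"
  assumes [measurable]: "\<And>n. U n \<in> borel_measurable M" "\<And>n. V n \<in> borel_measurable M"
    and diff: "\<And>e r. e > 0 \<Longrightarrow> r > 0 \<Longrightarrow>
      \<forall>\<^sub>F n in sequentially. prob {\<omega> \<in> space M. e \<le> \<bar>U n \<omega> - V n \<omega>\<bar>} < r"
    and U: "(\<lambda>n. char (distr M borel (U n)) t) \<longlonglongrightarrow> l"
  shows "(\<lambda>n. char (distr M borel (V n)) t) \<longlonglongrightarrow> l"
proof -
  have "(\<lambda>n. char (distr M borel (V n)) t - char (distr M borel (U n)) t) \<longlonglongrightarrow> 0"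
  proof (rule tendstoI)
    fix q :: real assume q: "q > 0"
    \<comment> \<open>Chosen to give \<open>\<bar>t\<bar> * e < q / 2\<close>; the added 1 covers
      \<open>t = 0\<close>. The bad event gets probability below \<open>q / 4\<close>, as it is
      counted twice.\<close>
    define e where "e = q / (2 * (\<bar>t\<bar> + 1))"
    have e: "e > 0" using q by (simp add: e_def add_pos_nonneg)
    have te: "\<bar>t\<bar> * e < q / 2"
    proof -
      have "\<bar>t\<bar> * e < (\<bar>t\<bar> + 1) * e" using e by (intro mult_strict_right_mono) auto
      also have "\<dots> = q / 2" by (simp add: e_def field_simps add_nonneg_eq_0_iff)
      finally show ?thesis .
    qed
    have "q / 4 > 0" using q by simp
    from diff[OF e this] show "\<forall>\<^sub>F n in sequentially.
      dist (char (distr M borel (V n)) t - char (distr M borel (U n)) t) 0 < q"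
    proof eventually_elim
      case (elim n)
      let ?D = "{\<omega> \<in> space M. e \<le> \<bar>U n \<omega> - V n \<omega>\<bar>}"
      have iV: "integrable M (\<lambda>\<omega>. iexp (t * V n \<omega>))" and iU: "integrable M (\<lambda>\<omega>. iexp (t * U n \<omega>))"
        by (intro integrable_iexp; simp)+
      have "char (distr M borel (V n)) t - char (distr M borel (U n)) t =
          (CLINT \<omega>|M. iexp (t * V n \<omega>) - iexp (t * U n \<omega>))"
        using iV iU by (simp add: char_def integral_distr)
      also have "cmod \<dots> \<le> expectation (\<lambda>\<omega>. cmod (iexp (t * V n \<omega>) - iexp (t * U n \<omega>)))"
        by (rule integral_norm_bound)
      also have "\<dots> \<le> expectation (\<lambda>\<omega>. \<bar>t\<bar> * e + 2 * indicator ?D \<omega>)"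
      proof (rule integral_mono)
        show "integrable M (\<lambda>\<omega>. cmod (iexp (t * V n \<omega>) - iexp (t * U n \<omega>)))"
          using iV iU by (intro integrable_norm Bochner_Integration.integrable_diff)
        show "integrable M (\<lambda>\<omega>. \<bar>t\<bar> * e + 2 * indicator ?D \<omega> :: real)"
          by (intro Bochner_Integration.integrable_add integrable_mult_right integrable_real_indicator)
             (auto simp: emeasure_eq_measure)
        fix \<omega> assume \<omega>: "\<omega> \<in> space M"
        show "cmod (iexp (t * V n \<omega>) - iexp (t * U n \<omega>)) \<le> \<bar>t\<bar> * e + 2 * indicator ?D \<omega>"
        proof (cases "\<omega> \<in> ?D")
          case True
          have "cmod (iexp (t * V n \<omega>) - iexp (t * U n \<omega>)) \<le> cmod (iexp (t * V n \<omega>)) + cmod (iexp (t * U n \<omega>))"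
            by (rule norm_triangle_ineq4)
          also have "\<dots> = 2" by (simp del: of_real_mult)
          finally show ?thesis using True e by (simp add: add_increasing)
        next
          case False
          have "iexp (t * V n \<omega>) = iexp (t * U n \<omega>) * iexp (t * (V n \<omega> - U n \<omega>))"
            by (simp add: exp_add[symmetric] algebra_simps)
          then have "iexp (t * V n \<omega>) - iexp (t * U n \<omega>) = iexp (t * U n \<omega>) * (iexp (t * (V n \<omega> - U n \<omega>)) - 1)"
            by (simp add: algebra_simps)
          then have "cmod (iexp (t * V n \<omega>) - iexp (t * U n \<omega>)) = cmod (iexp (t * (V n \<omega> - U n \<omega>)) - 1)"
            by (simp add: norm_mult del: of_real_mult)
          also have "\<dots> \<le> \<bar>t * (V n \<omega> - U n \<omega>)\<bar>"
            using iexp_approx1[of "t * (V n \<omega> - U n \<omega>)" 0] by simp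
          also have "\<dots> \<le> \<bar>t\<bar> * e"
            using False \<omega> by (auto simp: abs_mult abs_minus_commute intro!: mult_left_mono)
          finally show ?thesis using False by simp
        qed
      qed
      also have "\<dots> = \<bar>t\<bar> * e + 2 * prob ?D"
        by (subst Bochner_Integration.integral_add) (auto simp: prob_space emeasure_eq_measure intro!: integrable_real_indicator)
      also have "\<dots> < q" using te elim by linarith
      finally show ?case by simp
    qed
  qed
  from tendsto_add[OF this U] show ?thesis by simp
qed

section \<open>Asymptotics of the studentized coefficients\<close>

locale orthogonal_regression = prob_space M for M :: "'a measure" +
  fixes K :: nat and X :: "nat \<Rightarrow> nat \<Rightarrow> nat \<Rightarrow> real" and \<epsilon> :: "nat \<Rightarrow> 'a \<Rightarrow> real"
    and \<sigma>0 Mb :: real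
  assumes design: "K < n \<Longrightarrow> orthogonal_design K n (X n)"
    and eps_indep: "indep_vars (\<lambda>_. borel) \<epsilon> UNIV"
    and eps_int4: "integrable M (\<lambda>\<omega>. (\<epsilon> i \<omega>) ^ 4)"
    and eps_mean: "expectation (\<epsilon> i) = 0"
    and eps_var: "expectation (\<lambda>\<omega>. (\<epsilon> i \<omega>)\<^sup>2) = \<sigma>0\<^sup>2"
    and sig_pos: "\<sigma>0 > 0"
    and eps_4th: "expectation (\<lambda>\<omega>. (\<epsilon> i \<omega>) ^ 4) \<le> Mb"
begin

text \<open>For \<open>n > K\<close> this is the estimation error of OLS in coordinate
  \<open>k\<close>.\<close>

definition score :: "nat \<Rightarrow> nat \<Rightarrow> 'a \<Rightarrow> real" where
  "score n k \<omega> = (\<Sum>i<n. X n i k * \<epsilon> i \<omega>) / n"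

text \<open>Unlike \<open>sigma_hat2\<close>, whose definite description may be unspecified for \<open>n \<le> K\<close>, this
  expression is measurable for every \<open>n\<close>.\<close>

definition resid_var :: "nat \<Rightarrow> 'a \<Rightarrow> real" where
  "resid_var n \<omega> = ((\<Sum>i<n. (\<epsilon> i \<omega>)\<^sup>2) - real n * (\<Sum>k<K. (score n k \<omega>)\<^sup>2)) / (real n - real K)"

lemma sigma_hat2_eq_resid_var:
  "K < n \<Longrightarrow> sigma_hat2 K n (X n) (\<lambda>i. (\<Sum>l<K. X n i l * \<beta> l) + \<epsilon> i \<omega>) = resid_var n \<omega>"
  by (simp add: sigma_hat2_regression[OF design] resid_var_def score_def)

lemma eps_measurable [measurable]: "\<epsilon> i \<in> borel_measurable M"
  using eps_indep by (simp add: indep_vars_def2)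

lemma eps_int2: "integrable M (\<lambda>\<omega>. (\<epsilon> i \<omega>)\<^sup>2)"
  using eps_int4[of i]
  by - (rule square_integrable_imp_integrable, auto simp: power2_eq_square power4_eq_xxxx mult.assoc)

lemma score_measurable [measurable]: "score n k \<in> borel_measurable M"
  unfolding score_def[abs_def] by measurable

lemma resid_var_measurable [measurable]: "resid_var n \<in> borel_measurable M"
  unfolding resid_var_def[abs_def] by measurable

lemma sum_design_squares: "K < n \<Longrightarrow> k < K \<Longrightarrow> (\<Sum>i<n. (X n i k)\<^sup>2) = n"
  using design[of n] by (simp add: orthogonal_design_def power2_eq_square)

text \<open>Chebyshev: the squared entries of column \<open>k\<close> sum to \<open>n\<close>, so
  the score has variance \<open>\<sigma>0\<^sup>2 / n\<close>.\<close>

lemma prob_score_ge: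
  assumes n: "K < n" and k: "k < K" and d: "d > 0"
  shows "prob {\<omega> \<in> space M. d \<le> \<bar>score n k \<omega>\<bar>} \<le> \<sigma>0\<^sup>2 / d\<^sup>2 / n"
proof -
  let ?Z = "\<lambda>i \<omega>. X n i k / n * \<epsilon> i \<omega>"
  have "prob {\<omega> \<in> space M. d \<le> \<bar>\<Sum>i<n. ?Z i \<omega>\<bar>} \<le> (\<Sum>i<n. expectation (\<lambda>\<omega>. (?Z i \<omega>)\<^sup>2)) / d\<^sup>2"
  proof (rule Chebyshev_indep_sum)
    show "indep_vars (\<lambda>_. borel) ?Z {..<n}"
      by (rule indep_vars_compose2[where X=\<epsilon>], rule indep_vars_subset[OF eps_indep]) auto
  qed (use d in \<open>auto simp: power_mult_distrib power_divide eps_int2 eps_mean\<close>)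
  also have "(\<Sum>i<n. expectation (\<lambda>\<omega>. (?Z i \<omega>)\<^sup>2)) = \<sigma>0\<^sup>2 / n"
    using n sum_design_squares[OF n k]
    by (simp add: power_mult_distrib power_divide eps_var flip: sum_distrib_right sum_divide_distrib)
       (simp add: power2_eq_square)
  finally show ?thesis by (simp add: score_def sum_divide_distrib mult.commute)
qed

text \<open>A weak law for the squared errors: their variance is at most the fourth moment, hence at
  most \<open>Mb\<close>.\<close>

lemma prob_mean_square_ge:
  assumes n: "0 < n" and d: "d > 0"
  shows "prob {\<omega> \<in> space M. d \<le> \<bar>(\<Sum>i<n. (\<epsilon> i \<omega>)\<^sup>2) / n - \<sigma>0\<^sup>2\<bar>} \<le> Mb / d\<^sup>2 / n"
proof -
  let ?Z = "\<lambda>i \<omega>. ((\<epsilon> i \<omega>)\<^sup>2 - \<sigma>0\<^sup>2) / n"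
  have sq: "(?Z i \<omega>)\<^sup>2 = ((\<epsilon> i \<omega>) ^ 4 - 2 * \<sigma>0\<^sup>2 * (\<epsilon> i \<omega>)\<^sup>2 + \<sigma>0 ^ 4) / (real n)\<^sup>2" for i \<omega>
    by (simp add: power_divide power2_diff power4_eq_xxxx)
  have "prob {\<omega> \<in> space M. d \<le> \<bar>\<Sum>i<n. ?Z i \<omega>\<bar>} \<le> (\<Sum>i<n. expectation (\<lambda>\<omega>. (?Z i \<omega>)\<^sup>2)) / d\<^sup>2"
  proof (rule Chebyshev_indep_sum)
    show "indep_vars (\<lambda>_. borel) ?Z {..<n}"
      by (rule indep_vars_compose2[where X=\<epsilon>], rule indep_vars_subset[OF eps_indep]) auto
    show "integrable M (\<lambda>\<omega>. (?Z i \<omega>)\<^sup>2)" for i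
      unfolding sq using eps_int4[of i] eps_int2[of i] by simp
  qed (use d in \<open>auto simp: eps_int2 eps_var prob_space\<close>)
  also have "(\<Sum>i<n. expectation (\<lambda>\<omega>. (?Z i \<omega>)\<^sup>2)) \<le> (\<Sum>i<n. Mb / (real n)\<^sup>2)"
  proof (rule sum_mono)
    fix i
    have "expectation (\<lambda>\<omega>. (?Z i \<omega>)\<^sup>2) = (expectation (\<lambda>\<omega>. (\<epsilon> i \<omega>) ^ 4) - \<sigma>0 ^ 4) / (real n)\<^sup>2"
      unfolding sq using eps_int4[of i] eps_int2[of i]
      by (simp add: eps_var prob_space flip: power_add)
    also have "\<dots> \<le> Mb / (real n)\<^sup>2"
    proof (rule divide_right_mono)
      have "0 \<le> \<sigma>0 ^ 4" by simp
      then show "expectation (\<lambda>\<omega>. (\<epsilon> i \<omega>) ^ 4) - \<sigma>0 ^ 4 \<le> Mb"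
        using eps_4th[of i] by linarith
    qed simp
    finally show "expectation (\<lambda>\<omega>. (?Z i \<omega>)\<^sup>2) \<le> Mb / (real n)\<^sup>2" .
  qed
  also have "(\<Sum>i<n. Mb / (real n)\<^sup>2) = Mb / n" using n by (simp add: power2_eq_square)
  also have "(\<lambda>\<omega>. \<Sum>i<n. ?Z i \<omega>) = (\<lambda>\<omega>. (\<Sum>i<n. (\<epsilon> i \<omega>)\<^sup>2) / n - \<sigma>0\<^sup>2)"
    using n by (simp add: diff_divide_distrib sum_subtractf sum_divide_distrib)
  finally show ?thesis using d by (simp add: divide_right_mono mult.commute)
qed

text \<open>Collects all consistency statements into one exceptional event of vanishing probability.
  Outside it the later arguments are deterministic estimates in a fixed
  \<open>\<omega>\<close>.\<close>

lemma resid_var_score_in_prob: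
  assumes d: "d > 0"
  obtains A where "\<And>n. A n \<in> events" "(\<lambda>n. prob (A n)) \<longlonglongrightarrow> 0"
    "\<forall>\<^sub>F n in sequentially. \<forall>\<omega>\<in>space M - A n. \<bar>resid_var n \<omega> - \<sigma>0\<^sup>2\<bar> < d \<and> (\<forall>k<K. \<bar>score n k \<omega>\<bar> < d)"
proof -
  \<comment> \<open>The bound \<open>d\<close> serves the scores, the bound 1 makes their squares at
    most \<open>a\<close>, and the last term keeps \<open>2 * (a + K * a)\<close> below
    \<open>d / 2\<close>.\<close>
  define a where "a = min (min d 1) (d / (4 * (real K + 1)))"
  have a: "0 < a" "a \<le> d" "a \<le> 1" "2 * (a + K * a) \<le> d / 2"
  proof -
    have "a * (4 * (real K + 1)) \<le> d / (4 * (real K + 1)) * (4 * (real K + 1))"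
      by (intro mult_right_mono) (auto simp: a_def)
    also have "\<dots> = d" by simp
    finally show "2 * (a + K * a) \<le> d / 2" by (simp add: algebra_simps)
  qed (use d in \<open>auto simp: a_def add_nonneg_pos\<close>)
  define A1 where "A1 n = {\<omega> \<in> space M. a \<le> \<bar>(\<Sum>i<n. (\<epsilon> i \<omega>)\<^sup>2) / n - \<sigma>0\<^sup>2\<bar>}" for n
  define A2 where "A2 n k = {\<omega> \<in> space M. a \<le> \<bar>score n k \<omega>\<bar>}" for n k
  define A where "A n = A1 n \<union> (\<Union>k<K. A2 n k)" for n
  have [measurable]: "A1 n \<in> events" "A2 n k \<in> events" for n k
    unfolding A1_def A2_def by measurable
  have A: "A n \<in> events" for n unfolding A_def by measurable
  have bound: "\<forall>\<^sub>F n in sequentially. prob (A n) \<le> (Mb / a\<^sup>2 + K * (\<sigma>0\<^sup>2 / a\<^sup>2)) / n"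
    using eventually_gt_at_top[of K]
  proof eventually_elim
    case (elim n)
    have "prob (A n) \<le> prob (A1 n) + prob (\<Union>k<K. A2 n k)"
      unfolding A_def by (intro measure_Un_le) auto
    also have "prob (\<Union>k<K. A2 n k) \<le> (\<Sum>k<K. prob (A2 n k))"
      by (intro measure_UNION_le) auto
    also have "\<dots> \<le> (\<Sum>k<K. \<sigma>0\<^sup>2 / a\<^sup>2 / n)"
      unfolding A2_def using elim a by (intro sum_mono prob_score_ge) auto
    also have "prob (A1 n) \<le> Mb / a\<^sup>2 / n"
      unfolding A1_def using elim a by (intro prob_mean_square_ge) auto
    finally show ?case by (simp add: add_divide_distrib)
  qed
  have lim: "(\<lambda>n. prob (A n)) \<longlonglongrightarrow> 0"
  proof (rule tendsto_sandwich[OF _ bound, where f="\<lambda>_. 0"])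
    show "(\<lambda>n. (Mb / a\<^sup>2 + K * (\<sigma>0\<^sup>2 / a\<^sup>2)) / real n) \<longlonglongrightarrow> 0"
      by (rule lim_const_over_n)
  qed auto
  \<comment> \<open>The degrees-of-freedom correction. The other half of \<open>d\<close> is spent
    on its deviation from 1.\<close>
  define r where "r n = real n / (real n - real K)" for n
  have r: "r \<longlonglongrightarrow> 1" unfolding r_def by real_asymp
  have "(\<lambda>n. (r n - 1) * \<sigma>0\<^sup>2) \<longlonglongrightarrow> (1 - 1) * \<sigma>0\<^sup>2" by (intro tendsto_intros r)
  then have ev1: "\<forall>\<^sub>F n in sequentially. (r n - 1) * \<sigma>0\<^sup>2 < d / 2"
    using d by (intro order_tendstoD(2)) auto
  have ev2: "\<forall>\<^sub>F n in sequentially. r n < 2"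
    using r by (intro order_tendstoD(2)) auto
  have "\<forall>\<^sub>F n in sequentially. \<forall>\<omega>\<in>space M - A n. \<bar>resid_var n \<omega> - \<sigma>0\<^sup>2\<bar> < d \<and> (\<forall>k<K. \<bar>score n k \<omega>\<bar> < d)"
    using ev1 ev2 eventually_gt_at_top[of K]
  proof eventually_elim
    case (elim n)
    show ?case
    proof
      fix \<omega> assume \<omega>: "\<omega> \<in> space M - A n"
      define m where "m = (\<Sum>i<n. (\<epsilon> i \<omega>)\<^sup>2) / n"
      define q where "q = (\<Sum>k<K. (score n k \<omega>)\<^sup>2)"
      have m: "\<bar>m - \<sigma>0\<^sup>2\<bar> < a" using \<omega> by (auto simp: A_def A1_def m_def)
      have s: "\<bar>score n k \<omega>\<bar> < a" if "k < K" for k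
        using \<omega> that by (auto simp: A_def A2_def not_le)
      have q: "0 \<le> q" "q \<le> K * a"
      proof -
        have "q \<le> (\<Sum>k<K. a)"
          unfolding q_def
        proof (rule sum_mono)
          fix k assume "k \<in> {..<K}"
          then have "(score n k \<omega>)\<^sup>2 \<le> a\<^sup>2"
            using s[of k] a by (intro power2_le_iff_abs_le[THEN iffD2]) auto
          also have "a\<^sup>2 \<le> a" using a by (simp add: power2_eq_square mult_left_le)
          finally show "(score n k \<omega>)\<^sup>2 \<le> a" .
        qed
        then show "q \<le> K * a" by simp
      qed (simp add: q_def sum_nonneg)
      have r1: "1 \<le> r n" using elim by (simp add: r_def)
      have eq: "resid_var n \<omega> - \<sigma>0\<^sup>2 = r n * (m - \<sigma>0\<^sup>2) + (r n - 1) * \<sigma>0\<^sup>2 - r n * q"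
      proof -
        have "(\<Sum>i<n. (\<epsilon> i \<omega>)\<^sup>2) = n * m" using elim by (simp add: m_def)
        then have "resid_var n \<omega> = r n * (m - q)"
          by (simp add: resid_var_def q_def r_def right_diff_distrib diff_divide_distrib)
        then show ?thesis by (simp add: algebra_simps)
      qed
      have "\<bar>resid_var n \<omega> - \<sigma>0\<^sup>2\<bar> \<le> r n * \<bar>m - \<sigma>0\<^sup>2\<bar> + (r n - 1) * \<sigma>0\<^sup>2 + r n * q"
      proof -
        have "0 \<le> (r n - 1) * \<sigma>0\<^sup>2" "0 \<le> r n * q" using r1 q by auto
        moreover have "\<bar>r n * (m - \<sigma>0\<^sup>2)\<bar> = r n * \<bar>m - \<sigma>0\<^sup>2\<bar>" using r1 by (simp add: abs_mult)
        ultimately show ?thesis unfolding eq by linarith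
      qed
      also have "\<dots> < 2 * a + d / 2 + 2 * (K * a)"
      proof -
        have "r n * \<bar>m - \<sigma>0\<^sup>2\<bar> \<le> 2 * a" "r n * q \<le> 2 * (K * a)"
          using elim m q r1 by (intro mult_mono; simp)+
        then show ?thesis using elim by linarith
      qed
      also have "\<dots> \<le> d" using a by (simp add: algebra_simps)
      finally show "\<bar>resid_var n \<omega> - \<sigma>0\<^sup>2\<bar> < d \<and> (\<forall>k<K. \<bar>score n k \<omega>\<bar> < d)"
        using s a by (auto intro: less_le_trans)
    qed
  qed
  with A lim show ?thesis by (rule that)
qed

section \<open>The studentized coefficient and its two uses\<close>

text \<open>The statistic \<open>\<xi>\<close> written through the errors. Built on
  \<open>resid_var\<close>, it is measurable for every \<open>n\<close>, and it agrees with
  \<open>\<xi>\<close> once \<open>n > K\<close>.\<close>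

definition coef_stat :: "(nat \<Rightarrow> real) \<Rightarrow> nat \<Rightarrow> nat \<Rightarrow> 'a \<Rightarrow> real" where
  "coef_stat \<beta> n k \<omega> = sqrt n * (\<beta> k + score n k \<omega>) / sqrt (resid_var n \<omega>)"

lemma sum_design_response:
  assumes "K < n" "k < K"
  shows "(\<Sum>i<n. X n i k * ((\<Sum>l<K. X n i l * \<beta> l) + \<epsilon> i \<omega>)) = n * (\<beta> k + score n k \<omega>)"
  using assms by (simp add: distrib_left sum.distrib orthogonal_design_normal_equations[OF design] score_def)

text \<open>The rescaling of the data is such that the argument of \<open>shrinkage_factor\<close>
  in the marginal likelihood is exactly the studentized coefficient.\<close>

lemma sum_design_ystar:
  assumes "K < n" "k < K"
  shows "(\<Sum>i<n. X n i k * ystar K n (X n) (\<lambda>i. (\<Sum>l<K. X n i l * \<beta> l) + \<epsilon> i \<omega>) i) / n = coef_stat \<beta> n k \<omega>"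
proof -
  let ?c = "sqrt n / sqrt (resid_var n \<omega>)"
  have "(\<Sum>i<n. X n i k * ystar K n (X n) (\<lambda>i. (\<Sum>l<K. X n i l * \<beta> l) + \<epsilon> i \<omega>) i) =
     ?c * (\<Sum>i<n. X n i k * ((\<Sum>l<K. X n i l * \<beta> l) + \<epsilon> i \<omega>))"
    using assms by (simp add: ystar_def sigma_hat2_eq_resid_var) (simp add: sum_distrib_left sum_divide_distrib mult_ac)
  then show ?thesis
    using assms by (simp add: sum_design_response coef_stat_def)
qed

lemma studentized_coef_eq_coef_stat:
  assumes "K < n" "k < K"
  shows "(\<Sum>i<n. X n i k * ((\<Sum>l<K. X n i l * \<beta> l) + \<epsilon> i \<omega>)) /
      (sqrt (sigma_hat2 K n (X n) (\<lambda>i. (\<Sum>l<K. X n i l * \<beta> l) + \<epsilon> i \<omega>)) * sqrt n) = coef_stat \<beta> n k \<omega>"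
proof -
  have "sqrt n * sqrt n = real n" by simp
  then have "real n / sqrt n = sqrt n" using assms by (simp add: divide_eq_eq)
  then show ?thesis
    using assms unfolding sum_design_response[OF assms] sigma_hat2_eq_resid_var[OF assms(1)] coef_stat_def
    by (metis (no_types, lifting) mult.commute times_divide_eq_left divide_divide_eq_left')
qed

text \<open>On the good event every squared statistic is \<open>n / v\<close> times a bounded
  quantity, and the one for \<open>k\<close> stays away from zero at this scale. A box far enough
  out makes the exponent of the general bound at most \<open>- c * n\<close>.\<close>

lemma posterior_concentrates:
  fixes \<pi> :: "(nat \<Rightarrow> real) measure"
  assumes \<pi>: "prob_space \<pi>" and sets: "sets \<pi> = sets (\<Pi>\<^sub>M k\<in>{..<K}. (borel :: real measure))"
    and pos: "AE \<gamma> in \<pi>. \<forall>k<K. 0 < \<gamma> k" and h_nonneg: "0 \<le> h"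
    and supp: "\<And>\<gamma>. (\<forall>k<K. h \<le> \<gamma> k) \<Longrightarrow> in_support K \<pi> \<gamma>"
    and \<delta>: "0 < \<delta>" "\<delta> < 1" and k: "k < K" and \<beta>: "\<beta> k \<noteq> 0"
  shows "conv_in_prob M (\<lambda>n \<omega>. posterior \<pi> (ss_lik K n (X n) n
      (ystar K n (X n) (\<lambda>i. (\<Sum>l<K. X n i l * \<beta> l) + \<epsilon> i \<omega>))) {\<gamma> \<in> space \<pi>. \<gamma> k / (1 + \<gamma> k) > 1 - \<delta>}) 1"
proof -
  interpret \<pi>: prob_space \<pi> by fact
  \<comment> \<open>On the good event \<open>\<delta> * (\<beta> k + s k)\<^sup>2\<close> is at
    least \<open>2 * b\<close>, as the score is at most half of \<open>\<beta> k\<close> in absolute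
    value. \<open>T\<close> is chosen so that the competing term is at most \<open>b\<close>, which
    leaves a net gain of \<open>b\<close>.\<close>
  define b where "b = \<delta> * (\<beta> k)\<^sup>2 / 8"
  define Q where "Q = (\<Sum>l<K. (\<bar>\<beta> l\<bar> + 1)\<^sup>2)"
  define T where "T = h + Q / b"
  define p where "p = measure \<pi> {\<gamma> \<in> space \<pi>. \<forall>l<K. T \<le> \<gamma> l \<and> \<gamma> l \<le> T + 2}"
  define D where "D = p * ((1 + (T + 2)) powr (-1/2)) ^ K"
  define d where "d = min (min 1 (\<bar>\<beta> k\<bar> / 2)) (\<sigma>0\<^sup>2 / 2)"
  \<comment> \<open>The rate \<open>b / (2 * v)\<close> at the crude upper bound
    \<open>v \<le> 2 * \<sigma>0\<^sup>2\<close>.\<close>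
  define c where "c = b / (4 * \<sigma>0\<^sup>2)"
  have b: "b > 0" using \<delta> \<beta> by (simp add: b_def)
  have Q: "Q \<ge> 0" by (simp add: Q_def sum_nonneg)
  have T: "T \<ge> 0" "T \<ge> h" using h_nonneg b Q by (auto simp: T_def)
  have QT: "Q / (1 + T) \<le> b"
  proof -
    have "Q = b * (Q / b)" using b by simp
    also have "\<dots> \<le> b * (1 + T)" using b h_nonneg by (intro mult_left_mono) (auto simp: T_def)
    finally show ?thesis using T by (simp add: divide_le_eq)
  qed
  have c: "c > 0" using b sig_pos by (simp add: c_def)
  have d: "d > 0" using \<beta> sig_pos by (simp add: d_def)
  have p: "p > 0"
  proof -
    have [measurable]: "(\<lambda>\<gamma>. \<gamma> l) \<in> borel_measurable \<pi>" if "l < K" for l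
      using that measurable_component_singleton[of l "{..<K}" "\<lambda>_. borel :: real measure"]
      by (simp cong: measurable_cong_sets add: sets)
    \<comment> \<open>The open cube of radius 1 about this support point lies in the box, which
      therefore has positive prior mass.\<close>
    have "in_support K \<pi> (\<lambda>_. T + 1)" using T by (intro supp) auto
    then have "0 < emeasure \<pi> {\<gamma> \<in> space \<pi>. \<forall>l<K. \<bar>\<gamma> l - (T + 1)\<bar> < 1}"
      by (simp add: in_support_def)
    also have "\<dots> \<le> emeasure \<pi> {\<gamma> \<in> space \<pi>. \<forall>l<K. T \<le> \<gamma> l \<and> \<gamma> l \<le> T + 2}"
    proof (rule emeasure_mono)
      show "{\<gamma> \<in> space \<pi>. \<forall>l<K. T \<le> \<gamma> l \<and> \<gamma> l \<le> T + 2} \<in> sets \<pi>" by measurable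
    qed (fastforce simp: abs_less_iff)
    finally show ?thesis by (simp add: p_def \<pi>.emeasure_eq_measure)
  qed
  have D: "D > 0" using p T by (simp add: D_def)
  show ?thesis
    unfolding conv_in_prob_def
  proof (intro allI impI)
    fix e r :: real assume e: "e > 0" and r: "r > 0"
    obtain A where A: "\<And>n. A n \<in> events" "(\<lambda>n. prob (A n)) \<longlonglongrightarrow> 0"
      "\<forall>\<^sub>F n in sequentially. \<forall>\<omega>\<in>space M - A n. \<bar>resid_var n \<omega> - \<sigma>0\<^sup>2\<bar> < d \<and> (\<forall>k<K. \<bar>score n k \<omega>\<bar> < d)"
      using resid_var_score_in_prob[OF d] by blast
    have "(\<lambda>n. exp (- c * real n) / D) \<longlonglongrightarrow> 0" using c D by real_asymp
    then have ev1: "\<forall>\<^sub>F n in sequentially. exp (- c * real n) / D < e"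
      using e by (rule order_tendstoD(2))
    have ev2: "\<forall>\<^sub>F n in sequentially. prob (A n) < r"
      using A(2) r by (rule order_tendstoD(2))
    let ?P = "\<lambda>n \<omega>. posterior \<pi> (ss_lik K n (X n) n
      (ystar K n (X n) (\<lambda>i. (\<Sum>l<K. X n i l * \<beta> l) + \<epsilon> i \<omega>))) {\<gamma> \<in> space \<pi>. \<gamma> k / (1 + \<gamma> k) > 1 - \<delta>}"
    show "\<forall>\<^sub>F n in sequentially. \<exists>A\<in>events. prob A < r \<and> {\<omega> \<in> space M. e < \<bar>?P n \<omega> - 1\<bar>} \<subseteq> A"
      using ev1 ev2 A(3) eventually_gt_at_top[of K]
    proof eventually_elim
      case (elim n)
      have "\<bar>?P n \<omega> - 1\<bar> < e" if \<omega>: "\<omega> \<in> space M - A n" for \<omega>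
      proof -
        define v where "v = resid_var n \<omega>"
        define s where "s l = score n l \<omega>" for l
        have v': "\<bar>v - \<sigma>0\<^sup>2\<bar> < d" and s: "\<And>l. l < K \<Longrightarrow> \<bar>s l\<bar> < d"
          using elim(3) \<omega> by (auto simp: v_def s_def)
        have "\<bar>v - \<sigma>0\<^sup>2\<bar> < \<sigma>0\<^sup>2 / 2" using v' by (simp add: d_def)
        moreover have "0 < \<sigma>0\<^sup>2" using sig_pos by simp
        ultimately have v: "0 < v" "v \<le> 2 * \<sigma>0\<^sup>2" by linarith+
        have sq: "(coef_stat \<beta> n l \<omega>)\<^sup>2 = real n / v * (\<beta> l + s l)\<^sup>2" for l
          using v by (simp add: coef_stat_def v_def[symmetric] s_def[symmetric] power_divide power_mult_distrib)
        have up: "(\<Sum>l<K. (\<beta> l + s l)\<^sup>2) \<le> Q"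
          unfolding Q_def
        proof (rule sum_mono)
          fix l assume "l \<in> {..<K}"
          then have "\<bar>s l\<bar> \<le> 1" using s[of l] by (simp add: d_def)
          then have "\<bar>\<beta> l + s l\<bar> \<le> \<bar>\<bar>\<beta> l\<bar> + 1\<bar>" by linarith
          then show "(\<beta> l + s l)\<^sup>2 \<le> (\<bar>\<beta> l\<bar> + 1)\<^sup>2" by (simp only: abs_le_square_iff)
        qed
        have low: "2 * b \<le> \<delta> * (\<beta> k + s k)\<^sup>2"
        proof -
          have "\<bar>s k\<bar> \<le> \<bar>\<beta> k\<bar> / 2" using s[OF k] by (simp add: d_def)
          then have "\<bar>\<beta> k / 2\<bar> \<le> \<bar>\<beta> k + s k\<bar>" by linarith
          then have "(\<beta> k / 2)\<^sup>2 \<le> (\<beta> k + s k)\<^sup>2" by (simp only: abs_le_square_iff)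
          then have "\<delta> * (\<beta> k / 2)\<^sup>2 \<le> \<delta> * (\<beta> k + s k)\<^sup>2" using \<delta> by (intro mult_left_mono) auto
          then show ?thesis by (simp add: b_def power_divide)
        qed
        have "((\<Sum>l<K. (coef_stat \<beta> n l \<omega>)\<^sup>2) / (1 + T) - \<delta> * (coef_stat \<beta> n k \<omega>)\<^sup>2) / 2 =
            real n / (2 * v) * ((\<Sum>l<K. (\<beta> l + s l)\<^sup>2) / (1 + T) - \<delta> * (\<beta> k + s k)\<^sup>2)"
          unfolding sq sum_distrib_left[symmetric] by (simp add: right_diff_distrib diff_divide_distrib mult_ac)
        also have "\<dots> \<le> real n / (2 * v) * (- b)"
        proof (intro mult_left_mono)
          have "(\<Sum>l<K. (\<beta> l + s l)\<^sup>2) / (1 + T) \<le> Q / (1 + T)"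
            using up T by (intro divide_right_mono) auto
          then show "(\<Sum>l<K. (\<beta> l + s l)\<^sup>2) / (1 + T) - \<delta> * (\<beta> k + s k)\<^sup>2 \<le> - b"
            using QT low by linarith
        qed (use v in auto)
        also have "\<dots> \<le> - c * n"
        proof -
          have "b / (4 * \<sigma>0\<^sup>2) \<le> b / (2 * v)" using v b sig_pos by (intro divide_left_mono) auto
          then have "c * n \<le> b / (2 * v) * n" unfolding c_def by (intro mult_right_mono) auto
          then show ?thesis by (simp add: mult_ac)
        qed
        finally have ex: "((\<Sum>l<K. (coef_stat \<beta> n l \<omega>)\<^sup>2) / (1 + T) - \<delta> * (coef_stat \<beta> n k \<omega>)\<^sup>2) / 2 \<le> - c * n" .
        have "\<bar>?P n \<omega> - 1\<bar> \<le> exp (((\<Sum>l<K. (coef_stat \<beta> n l \<omega>)\<^sup>2) / (1 + T) - \<delta> * (coef_stat \<beta> n k \<omega>)\<^sup>2) / 2) / D"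
          using abs_posterior_minus_1_le[OF design \<pi> sets pos k \<delta> T(1) p_def p, of n
              "ystar K n (X n) (\<lambda>i. (\<Sum>l<K. X n i l * \<beta> l) + \<epsilon> i \<omega>)"] elim k
          by (simp add: sum_design_ystar D_def)
        also have "\<dots> \<le> exp (- c * n) / D"
          using ex D by (intro divide_right_mono) auto
        also have "\<dots> < e" using elim by simp
        finally show ?thesis .
      qed
      then have "{\<omega> \<in> space M. e < \<bar>?P n \<omega> - 1\<bar>} \<subseteq> A n" by fastforce
      then show ?case using A(1)[of n] elim(2) by blast
    qed
  qed
qed

lemma coef_stat_measurable [measurable]: "coef_stat \<beta> n k \<in> borel_measurable M"
  unfolding coef_stat_def[abs_def] by measurable

text \<open>For \<open>\<beta> k = 0\<close> the statistic is a weighted error sum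
  \<open>S n\<close> times \<open>\<sigma>0 / sqrt (resid_var n \<omega>)\<close>. Lyapunov's
  theorem treats the sum, Slutsky's lemma removes the factor tending to 1, and Levy's continuity
  theorem returns to distributions.\<close>

lemma coef_stat_asymptotically_normal:
  assumes k: "k < K" and \<beta>: "\<beta> k = 0"
    and Xmax: "(\<lambda>n. Max ((\<lambda>i. sqrt (\<Sum>k<K. (X n i k)\<^sup>2)) ` {..<n}) / sqrt (real n)) \<longlonglongrightarrow> 0"
  shows "weak_conv_m (\<lambda>n. distr M borel (coef_stat \<beta> n k)) std_normal_distribution"
proof (rule levy_continuity)
  fix t
  define a where "a n i = X n i k / (sqrt n * \<sigma>0)" for n i
  define S where "S n \<omega> = (\<Sum>i<n. a n i * \<epsilon> i \<omega>)" for n \<omega>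
  have [measurable]: "S n \<in> borel_measurable M" for n unfolding S_def[abs_def] by measurable
  have S_score: "S n \<omega> = sqrt n * score n k \<omega> / \<sigma>0" for n \<omega>
  proof -
    \<comment> \<open>For \<open>n = 0\<close> both sides are 0 by the convention on division, so
      the identity holds for every \<open>n\<close>.\<close>
    have "sqrt n * (W / n) = W / sqrt n" for W :: real
      by (cases "n = 0") (auto simp: field_simps simp flip: power2_eq_square)
    then show ?thesis
      by (simp add: S_def a_def score_def sum_divide_distrib[symmetric])
  qed
  have CLT: "(\<lambda>n. char (distr M borel (S n)) t) \<longlonglongrightarrow> exp (- t\<^sup>2 / 2)"
    unfolding S_def
  proof (rule Lyapunov_char_tendsto[OF eps_indep eps_mean eps_int4 eps_var sig_pos eps_4th])
    show "\<forall>\<^sub>F n in sequentially. (\<Sum>i<n. (a n i)\<^sup>2) = 1 / \<sigma>0\<^sup>2"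
      using eventually_gt_at_top[of K]
    proof eventually_elim
      case (elim n)
      then show ?case
        using sum_design_squares[OF elim k]
        by (simp add: a_def power_divide power_mult_distrib flip: sum_divide_distrib)
    qed
    show "(\<lambda>n. (Max ((\<lambda>i. sqrt (\<Sum>k<K. (X n i k)\<^sup>2)) ` {..<n}) / sqrt (real n)) / \<sigma>0) \<longlonglongrightarrow> 0"
      using tendsto_divide[OF Xmax tendsto_const[of \<sigma>0]] sig_pos by simp
    \<comment> \<open>An entry is bounded by the norm of its row, so the condition on the maximal
      row norm makes the weights uniformly negligible.\<close>
    show "\<forall>\<^sub>F n in sequentially. \<forall>i<n. \<bar>a n i\<bar> \<le> (Max ((\<lambda>i. sqrt (\<Sum>k<K. (X n i k)\<^sup>2)) ` {..<n}) / sqrt (real n)) / \<sigma>0"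
    proof (intro always_eventually allI impI)
      fix n i :: nat assume "i < n"
      have "\<bar>X n i k\<bar> = sqrt ((X n i k)\<^sup>2)" by simp
      also have "\<dots> \<le> sqrt (\<Sum>k<K. (X n i k)\<^sup>2)"
        using k by (intro real_sqrt_le_mono member_le_sum) auto
      also have "\<dots> \<le> Max ((\<lambda>i. sqrt (\<Sum>k<K. (X n i k)\<^sup>2)) ` {..<n})"
        using \<open>i < n\<close> by (intro Max_ge) auto
      finally show "\<bar>a n i\<bar> \<le> (Max ((\<lambda>i. sqrt (\<Sum>k<K. (X n i k)\<^sup>2)) ` {..<n}) / sqrt (real n)) / \<sigma>0"
        using sig_pos by (simp add: a_def abs_mult divide_right_mono)
    qed
  qed
  have "(\<lambda>n. char (distr M borel (coef_stat \<beta> n k)) t) \<longlonglongrightarrow> exp (- t\<^sup>2 / 2)"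
  proof (rule char_tendsto_diff_in_prob[OF _ _ _ CLT])
    fix e r :: real assume e: "e > 0" and r: "r > 0"
    \<comment> \<open>By Chebyshev \<open>\<bar>S n \<omega>\<bar>\<close> reaches \<open>R\<close>
      with probability at most \<open>1 / R\<^sup>2 = r / 2\<close>; the other half of
      \<open>r\<close> goes to the event where the variance estimate is off.\<close>
    define R where "R = sqrt (2 / r)"
    have R: "R > 0" "1 / R\<^sup>2 = r / 2" using r by (auto simp: R_def)
    have "isCont (\<lambda>v. \<sigma>0 / sqrt v) (\<sigma>0\<^sup>2)"
      using sig_pos by (intro continuous_intros) auto
    then have "((\<lambda>v. \<sigma>0 / sqrt v) \<longlongrightarrow> 1) (at (\<sigma>0\<^sup>2))"
      using sig_pos by (simp add: isCont_def)
    then have "\<forall>\<^sub>F v in at (\<sigma>0\<^sup>2). dist (\<sigma>0 / sqrt v) 1 < e / R"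
      using e R by (intro tendstoD) auto
    then obtain d where d: "d > 0" and d': "\<And>v. v \<noteq> \<sigma>0\<^sup>2 \<Longrightarrow> dist v (\<sigma>0\<^sup>2) < d \<Longrightarrow> dist (\<sigma>0 / sqrt v) 1 < e / R"
      by (auto simp: eventually_at)
    \<comment> \<open>The limit at \<open>\<sigma>0\<^sup>2\<close> only speaks of a punctured
      neighbourhood; at the centre the quotient equals 1.\<close>
    have d'': "\<bar>\<sigma>0 / sqrt v - 1\<bar> < e / R" if "\<bar>v - \<sigma>0\<^sup>2\<bar> < d" for v
      using d'[of v] that e R sig_pos by (cases "v = \<sigma>0\<^sup>2") (auto simp: dist_real_def)
    obtain A where A: "\<And>n. A n \<in> events" "(\<lambda>n. prob (A n)) \<longlonglongrightarrow> 0"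
      "\<forall>\<^sub>F n in sequentially. \<forall>\<omega>\<in>space M - A n. \<bar>resid_var n \<omega> - \<sigma>0\<^sup>2\<bar> < d \<and> (\<forall>k<K. \<bar>score n k \<omega>\<bar> < d)"
      using resid_var_score_in_prob[OF d] by blast
    have ev: "\<forall>\<^sub>F n in sequentially. prob (A n) < r / 2"
      using A(2) r by (intro order_tendstoD(2)) auto
    show "\<forall>\<^sub>F n in sequentially. prob {\<omega> \<in> space M. e \<le> \<bar>S n \<omega> - coef_stat \<beta> n k \<omega>\<bar>} < r"
      using ev A(3) eventually_gt_at_top[of K]
    proof eventually_elim
      case (elim n)
      let ?B = "{\<omega> \<in> space M. R * \<sigma>0 / sqrt n \<le> \<bar>score n k \<omega>\<bar>}"
      have n: "n > 0" using elim by simp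
      have sub: "{\<omega> \<in> space M. e \<le> \<bar>S n \<omega> - coef_stat \<beta> n k \<omega>\<bar>} \<subseteq> ?B \<union> A n"
      proof (rule subsetI, rule ccontr)
        fix \<omega> assume \<omega>: "\<omega> \<in> {\<omega> \<in> space M. e \<le> \<bar>S n \<omega> - coef_stat \<beta> n k \<omega>\<bar>}" "\<omega> \<notin> ?B \<union> A n"
        then have "\<bar>score n k \<omega>\<bar> < R * \<sigma>0 / sqrt n" by auto
        then have S: "\<bar>S n \<omega>\<bar> < R"
          using n sig_pos by (simp add: S_score abs_mult field_simps)
        have "\<bar>resid_var n \<omega> - \<sigma>0\<^sup>2\<bar> < d" using \<omega> elim by auto
        then have q: "\<bar>\<sigma>0 / sqrt (resid_var n \<omega>) - 1\<bar> < e / R" by (rule d'')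
        have "coef_stat \<beta> n k \<omega> = S n \<omega> * (\<sigma>0 / sqrt (resid_var n \<omega>))"
          using sig_pos by (simp add: coef_stat_def \<beta> S_score)
        then have "\<bar>S n \<omega> - coef_stat \<beta> n k \<omega>\<bar> = \<bar>S n \<omega>\<bar> * \<bar>\<sigma>0 / sqrt (resid_var n \<omega>) - 1\<bar>"
          by (simp add: abs_mult[symmetric] algebra_simps abs_minus_commute)
        also have "\<dots> < R * (e / R)"
          using S q by (intro mult_strict_mono') auto
        also have "\<dots> = e" using R by simp
        finally show False using \<omega> by simp
      qed
      have "prob {\<omega> \<in> space M. e \<le> \<bar>S n \<omega> - coef_stat \<beta> n k \<omega>\<bar>} \<le> prob (?B \<union> A n)"
        using A(1) by (intro finite_measure_mono sub) measurable
      also have "\<dots> \<le> prob ?B + prob (A n)"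
        using A(1) by (intro measure_Un_le) measurable
      also have "prob ?B \<le> \<sigma>0\<^sup>2 / (R * \<sigma>0 / sqrt n)\<^sup>2 / n"
        using elim k R sig_pos n by (intro prob_score_ge) auto
      also have "\<dots> = 1 / R\<^sup>2"
        using n sig_pos by (simp add: power_divide power_mult_distrib)
      finally show ?case using R elim by linarith
    qed
  qed measurable
  then show "(\<lambda>n. char (distr M borel (coef_stat \<beta> n k)) t) \<longlonglongrightarrow> char std_normal_distribution t"
    by (simp add: char_std_normal_distribution)
qed (auto intro!: real_dist_normal_dist)

end

section \<open>Transfer from \<open>coef_stat\<close> to the studentized coefficient itself\<close>

text \<open>Needed because \<open>\<xi>\<close> and \<open>coef_stat\<close> are identified only for
  \<open>n > K\<close>; weak convergence depends on the tail of the sequence alone.\<close>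

lemma weak_conv_m_cong_eventually:
  assumes "weak_conv_m N \<mu>" and "\<forall>\<^sub>F n in sequentially. N n = N' n"
  shows "weak_conv_m N' \<mu>"
  unfolding weak_conv_m_def weak_conv_def
proof (intro allI impI)
  fix x assume "isCont (cdf \<mu>) x"
  then have "(\<lambda>n. cdf (N n) x) \<longlonglongrightarrow> cdf \<mu> x"
    using assms(1) by (simp add: weak_conv_m_def weak_conv_def)
  then show "(\<lambda>n. cdf (N' n) x) \<longlonglongrightarrow> cdf \<mu> x"
    by (rule Lim_transform_eventually) (use assms(2) in \<open>auto elim: eventually_mono\<close>)
qed

theorem theorem6:
  fixes K :: nat and X :: "nat \<Rightarrow> nat \<Rightarrow> nat \<Rightarrow> real" and \<beta>0 :: "nat \<Rightarrow> real"
    and M :: "'a measure" and \<epsilon> :: "nat \<Rightarrow> 'a \<Rightarrow> real"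
    and \<sigma>0 Mb v0 a2 :: real and a1 :: nat
  assumes K1: "K \<ge> 1"
    and XtX: "\<And>n k l. n > K \<Longrightarrow> k < K \<Longrightarrow> l < K \<Longrightarrow>
               (\<Sum>i<n. X n i k * X n i l) = (if k = l then real n else 0)"
    and Xcent: "\<And>n k. n > K \<Longrightarrow> k < K \<Longrightarrow> (\<Sum>i<n. X n i k) = 0"
    and Xmax: "(\<lambda>n. Max ((\<lambda>i. sqrt (\<Sum>k<K. (X n i k)\<^sup>2)) ` {..<n}) / sqrt (real n))
                 \<longlonglongrightarrow> 0"
    and P: "prob_space M"
    and eps_meas: "\<And>i. \<epsilon> i \<in> borel_measurable M"
    and eps_indep: "prob_space.indep_vars M (\<lambda>_. borel) \<epsilon> UNIV"
    and eps_int4: "\<And>i. integrable M (\<lambda>\<omega>. (\<epsilon> i \<omega>) ^ 4)"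
    and eps_mean: "\<And>i. prob_space.expectation M (\<epsilon> i) = 0"
    and eps_var: "\<And>i. prob_space.expectation M (\<lambda>\<omega>. (\<epsilon> i \<omega>)\<^sup>2) = \<sigma>0\<^sup>2"
    and sig_pos: "\<sigma>0 > 0"
    and eps_4th: "\<And>i. prob_space.expectation M (\<lambda>\<omega>. (\<epsilon> i \<omega>) ^ 4) \<le> Mb"
    and v0: "v0 > 0" and a1: "a1 \<ge> 1" and a2: "a2 > 0"
  defines "Y \<equiv> (\<lambda>n \<omega> i. (\<Sum>k<K. X n i k * \<beta>0 k) + \<epsilon> i \<omega>)"
    and "\<xi> \<equiv> (\<lambda>n k \<omega>. (\<Sum>i<n. X n i k * ((\<Sum>l<K. X n i l * \<beta>0 l) + \<epsilon> i \<omega>)) /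
                  (sqrt (sigma_hat2 K n (X n) (\<lambda>i. (\<Sum>l<K. X n i l * \<beta>0 l) + \<epsilon> i \<omega>))
                   * sqrt (real n)))"
  shows
   "(\<forall>\<pi> \<eta>0. prob_space \<pi> \<and> sets \<pi> = sets (\<Pi>\<^sub>M k\<in>{..<K}. (borel :: real measure)) \<and>
        (AE \<gamma> in \<pi>. \<forall>k<K. 0 < \<gamma> k) \<and> 0 \<le> \<eta>0 \<and>
        (\<forall>\<gamma>. (\<forall>k<K. \<eta>0 \<le> \<gamma> k) \<longrightarrow> in_support K \<pi> \<gamma>)
      \<longrightarrow> (\<forall>\<delta>. 0 < \<delta> \<and> \<delta> < 1 \<longrightarrow> (\<forall>k<K. \<beta>0 k \<noteq> 0 \<longrightarrow>
            conv_in_prob M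
              (\<lambda>n \<omega>. posterior \<pi> (ss_lik K n (X n) (real n) (ystar K n (X n) (Y n \<omega>)))
                         {\<gamma> \<in> space \<pi>. \<gamma> k / (1 + \<gamma> k) > 1 - \<delta>}) 1)))
    \<and>
    (\<forall>n>K. \<forall>\<omega>\<in>space M. \<forall>w\<in>{0..1}. \<forall>k<K. \<forall>B\<in>sets (borel :: real measure).
       let f = (\<lambda>u. exp (u / (2 * (1 + u)) * (\<xi> n k \<omega>)\<^sup>2) * (1 + u) powr (-1/2) *
                    ((1 - w) * (v0 * u powi (-2) * gdens a1 a2 (v0 * inverse u)) +
                     w * (u powi (-2) * gdens a1 a2 (inverse u))))
       in posterior (bimodal_prior_given_w K v0 a1 a2 w)
            (ss_lik K n (X n) (real n) (ystar K n (X n) (Y n \<omega>)))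
            {\<gamma> \<in> space (bimodal_prior_given_w K v0 a1 a2 w). \<gamma> k \<in> B}
          = (\<integral>u. indicator (B \<inter> {0<..}) u * f u \<partial>lborel) /
            (\<integral>u. indicator {0<..} u * f u \<partial>lborel))
    \<and>
    (\<forall>k<K. \<beta>0 k = 0 \<longrightarrow>
       weak_conv_m (\<lambda>n. distr M borel (\<xi> n k)) (density lborel std_normal_density))"
proof -
  interpret orthogonal_regression M K X \<epsilon> \<sigma>0 Mb
    by (intro orthogonal_regression.intro orthogonal_regression_axioms.intro P eps_indep eps_int4
        eps_mean eps_var sig_pos eps_4th) (simp add: orthogonal_design_def XtX)
  have \<xi>: "\<xi> n k \<omega> = coef_stat \<beta>0 n k \<omega>" if "K < n" "k < K" for n k \<omega>
    unfolding \<xi>_def using that by (rule studentized_coef_eq_coef_stat)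
  have "conv_in_prob M (\<lambda>n \<omega>. posterior \<pi> (ss_lik K n (X n) (real n) (ystar K n (X n) (Y n \<omega>)))
      {\<gamma> \<in> space \<pi>. \<gamma> k / (1 + \<gamma> k) > 1 - \<delta>}) 1"
    if "prob_space \<pi>" "sets \<pi> = sets (\<Pi>\<^sub>M k\<in>{..<K}. (borel :: real measure))"
      "AE \<gamma> in \<pi>. \<forall>k<K. 0 < \<gamma> k" "0 \<le> \<eta>0" "\<forall>\<gamma>. (\<forall>k<K. \<eta>0 \<le> \<gamma> k) \<longrightarrow> in_support K \<pi> \<gamma>"
      "0 < \<delta>" "\<delta> < 1" "k < K" "\<beta>0 k \<noteq> 0" for \<pi> \<eta>0 \<delta> k
    unfolding Y_def using that by (intro posterior_concentrates[where h=\<eta>0]) auto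
  moreover have "let f = (\<lambda>u. exp (u / (2 * (1 + u)) * (\<xi> n k \<omega>)\<^sup>2) * (1 + u) powr (-1/2) *
                    ((1 - w) * (v0 * u powi (-2) * gdens a1 a2 (v0 * inverse u)) +
                     w * (u powi (-2) * gdens a1 a2 (inverse u))))
       in posterior (bimodal_prior_given_w K v0 a1 a2 w)
            (ss_lik K n (X n) (real n) (ystar K n (X n) (Y n \<omega>)))
            {\<gamma> \<in> space (bimodal_prior_given_w K v0 a1 a2 w). \<gamma> k \<in> B}
          = (\<integral>u. indicator (B \<inter> {0<..}) u * f u \<partial>lborel) /
            (\<integral>u. indicator {0<..} u * f u \<partial>lborel)"
    if n: "K < n" and w: "w \<in> {0..1}" and k: "k < K" and B [measurable]: "B \<in> sets borel" for n \<omega> w k B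
  proof -
    let ?s = "shrinkage_factor (coef_stat \<beta>0 n k \<omega>)"
    have "posterior (bimodal_prior_given_w K v0 a1 a2 w)
            (ss_lik K n (X n) (real n) (ystar K n (X n) (Y n \<omega>)))
            {\<gamma> \<in> space (bimodal_prior_given_w K v0 a1 a2 w). \<gamma> k \<in> B} =
        (\<integral>u. indicator B u * ?s u \<partial>bimodal_comp v0 a1 a2 w) / (\<integral>u. ?s u \<partial>bimodal_comp v0 a1 a2 w)"
      using posterior_bimodal_prior[OF v0 a1 a2 w design[OF n] k B, of "ystar K n (X n) (Y n \<omega>)"]
      unfolding Y_def sum_design_ystar[OF n k] .
    also have "\<dots> = (\<integral>u. indicator {0<..} u * (indicator B u * ?s u * bimodal_density v0 a1 a2 w u) \<partial>lborel) /
        (\<integral>u. indicator {0<..} u * (?s u * bimodal_density v0 a1 a2 w u) \<partial>lborel)"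
      by (simp add: integral_bimodal_comp[OF v0 a1 a2 w])
    finally show ?thesis
      \<comment> \<open>The product of \<open>shrinkage_factor\<close> and
        \<open>bimodal_density\<close> is the unnormalised density \<open>f\<close> up to reordering
        of factors.\<close>
      by (simp add: \<xi>[OF n k] shrinkage_factor_def bimodal_density_def indicator_inter_arith mult_ac)
  qed
  moreover have "weak_conv_m (\<lambda>n. distr M borel (\<xi> n k)) std_normal_distribution"
    if k: "k < K" "\<beta>0 k = 0" for k
  proof (rule weak_conv_m_cong_eventually[OF coef_stat_asymptotically_normal[of k \<beta>0, OF k Xmax]])
    show "\<forall>\<^sub>F n in sequentially. distr M borel (coef_stat \<beta>0 n k) = distr M borel (\<xi> n k)"
      using eventually_gt_at_top[of K] by eventually_elim (simp add: \<xi> k cong: distr_cong)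
  qed
  ultimately show ?thesis by blast
qed

end
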